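(* Let $\ell(k) := \lim_{n\to\infty} P(2n-1-|S-S| = k)$, where $S$ is a uniformly random subset of $[n]=\{0,\dots,n-1\}$ (this limit exists for every $k\ge 0$). Then \[ \begin{aligned} &0.12165 < \ell(0) < 0.12255, && 0.18434 < \ell(2) < 0.18614, && 0.18713 < \ell(4) < 0.18959,\\ &0.15728 < \ell(6) < 0.16019, && 0.11801 < \ell(8) < 0.12119, && 0.08188 < \ell(10) < 0.08523,\\ &0.05355 < \ell(12) < 0.05700, && 0.03334 < \ell(14) < 0.03685, && 0.01981 < \ell(16) < 0.02335,\\ &0.01115 < \ell(18) < 0.01471, && 0.00580 < \ell(20) < 0.00937. && \end{aligned} \]
   Context: For a positive integer $n$, $[n] := \{0,1,\dots,n-1\}$, and $S$ is chosen uniformly at random among all $2^n$ subsets of $[n]$. The difference set is $S-S := \{x-y : x,y \in S\}$. *)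

theory Defs
  imports "HOL-Probability.Probability"
begin

(* The infix minus on sets denotes relative complement, hence a separate constant. *)
definition difference_set :: "int set \<Rightarrow> int set" where
  "difference_set S = {x - y | x y. x \<in> S \<and> y \<in> S}"

(* The number of missing differences is computed in int to avoid truncated subtraction. *)
definition missing_prob :: "nat \<Rightarrow> nat \<Rightarrow> real" where
  "missing_prob n k =
     measure_pmf.prob (pmf_of_set (Pow {0..<int n}))
       {S. 2 * int n - 1 - int (card (difference_set S)) = int k}"

definition ell :: "nat \<Rightarrow> real" where
  "ell k = lim (\<lambda>n. missing_prob n k)"

end

theory Submission imports Defs begin

text \<open>
  Near its two ends, a random subset of \<open>{0..<n}\<close> looks like two independent random sets
  \<open>A\<close> and \<open>B\<close> of natural numbers, the second one read backwards from \<open>n - 1\<close>. The difference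
  \<open>n - 1 - d\<close> with small \<open>d\<close> is present iff \<open>d \<in> A + B\<close>, and all other differences are present up to a
  probability that is small uniformly in \<open>n\<close>. Hence \<open>ell (2 * j)\<close> is the probability that \<open>A + B\<close>
  has exactly \<open>j\<close> gaps. Splitting off the minima of \<open>A\<close> and \<open>B\<close>, each of which shifts \<open>A + B\<close>,
  turns this into the expectation of a function of the number of gaps under the condition \<open>0 \<in> A \<inter> B\<close>.

  That expectation is bounded by a case tree over the elements of \<open>A\<close> and \<open>B\<close> below \<open>k\<close>. At a leaf
  with \<open>c\<close> gaps below \<open>k\<close>, let \<open>x\<close> be the random number of gaps from \<open>k\<close> on. Every fixed number
  is a gap with an explicit product probability, so the mean of \<open>x\<close> has an explicit upper bound
  \<open>lam\<close>, and the probability of \<open>x > 0\<close> is at least the probability \<open>mu\<close> that the first undecided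
  number is a gap. A pointwise bound \<open>h (c + x) \<ge> a c + b c * [x > 0] - s c * x\<close> then
  contributes \<open>a c + b c * mu - s c * lam\<close> to a lower bound of the expectation of \<open>h\<close>.
\<close>

section \<open>Gaps of the sum of two random sets\<close>

definition unrep :: "nat set \<Rightarrow> nat set \<Rightarrow> nat \<Rightarrow> bool" where
  "unrep A B d \<longleftrightarrow> (\<forall>i\<le>d. i \<in> A \<longrightarrow> d - i \<notin> B)"

definition gaps :: "nat \<Rightarrow> nat set \<Rightarrow> nat set \<Rightarrow> nat" where
  "gaps N A B = card {d. d < N \<and> unrep A B d}"

text \<open>The mean over independent fair coins that decide, for each of \<open>k\<close>, ...,
  \<open>k + n - 1\<close>, its membership in either set. Both coins of a number are tossed in one
  step, which is the branching of the case tree.\<close>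

fun expect :: "nat \<Rightarrow> nat \<Rightarrow> nat set \<Rightarrow> nat set \<Rightarrow> (nat set \<Rightarrow> nat set \<Rightarrow> real) \<Rightarrow> real" where
  "expect 0 k A B f = f A B"
| "expect (Suc n) k A B f =
     (expect n (Suc k) A B f + expect n (Suc k) (insert k A) B f +
      expect n (Suc k) A (insert k B) f + expect n (Suc k) (insert k A) (insert k B) f) / 4"

lemma expect_add: "expect n k A B (\<lambda>A B. f A B + g A B) = expect n k A B f + expect n k A B g"
  by (induction n arbitrary: k A B) (simp_all add: field_simps)

lemma expect_scale: "expect n k A B (\<lambda>A B. x * f A B) = x * expect n k A B f"
  by (induction n arbitrary: k A B) (simp_all add: field_simps)

lemma expect_const [simp]: "expect n k A B (\<lambda>A B. x) = x"
  by (induction n arbitrary: k A B) simp_all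

lemma expect_sum: "expect n k A B (\<lambda>A B. \<Sum>i\<in>I. f i A B) = (\<Sum>i\<in>I. expect n k A B (f i))"
  by (induction I rule: infinite_finite_induct) (simp_all add: expect_add)

text \<open>Only completions of \<open>A\<close> and \<open>B\<close> have to be compared, so the
  comparison may use the decided memberships.\<close>

lemma expect_mono:
  assumes "A \<subseteq> {..<k}" "B \<subseteq> {..<k}"
    and "\<And>A' B'. A' \<inter> {..<k} = A \<Longrightarrow> B' \<inter> {..<k} = B \<Longrightarrow>
           A' \<subseteq> {..<k + n} \<Longrightarrow> B' \<subseteq> {..<k + n} \<Longrightarrow> f A' B' \<le> g A' B'"
  shows "expect n k A B f \<le> expect n k A B g"
  using assms
proof (induction n arbitrary: k A B)
  case 0
  then show ?case by (simp add: Int_absorb2)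
next
  case (Suc n)
  have step: "expect n (Suc k) A1 B1 f \<le> expect n (Suc k) A1 B1 g"
    if "A1 = A \<or> A1 = insert k A" "B1 = B \<or> B1 = insert k B" for A1 B1
  proof (rule Suc.IH)
    show "A1 \<subseteq> {..<Suc k}" "B1 \<subseteq> {..<Suc k}"
      using that Suc.prems(1,2) by auto
  next
    fix A' B' assume a: "A' \<inter> {..<Suc k} = A1" "B' \<inter> {..<Suc k} = B1"
      "A' \<subseteq> {..<Suc k + n}" "B' \<subseteq> {..<Suc k + n}"
    have "A' \<inter> {..<k} = A1 \<inter> {..<k}" "B' \<inter> {..<k} = B1 \<inter> {..<k}"
      using a by auto
    then have "A' \<inter> {..<k} = A" "B' \<inter> {..<k} = B"
      using that Suc.prems(1,2) by auto
    then show "f A' B' \<le> g A' B'"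
      using a by (intro Suc.prems(3)) auto
  qed
  show ?case
    using step[of A B] step[of "insert k A" B] step[of A "insert k B"] step[of "insert k A" "insert k B"]
    by simp
qed

text \<open>The conditional probability that the pair \<open>i\<close>, \<open>j\<close> does not represent \<open>i + j\<close>, when the
  membership of the numbers below \<open>k\<close> is known and the other memberships are fair coin flips.\<close>

definition pair_prob :: "nat \<Rightarrow> nat set \<Rightarrow> nat set \<Rightarrow> nat \<Rightarrow> nat \<Rightarrow> real" where
  "pair_prob k A B i j =
     (if i < k then (if j < k then (if i \<in> A \<and> j \<in> B then 0 else 1) else (if i \<in> A then 1/2 else 1))
      else (if j < k then (if j \<in> B then 1/2 else 1) else 3/4))"

text \<open>A product, because the pairs \<open>(i, d - i)\<close> involve pairwise different coins:
  \<open>i\<close> is looked up in \<open>A\<close> and \<open>d - i\<close> in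
  \<open>B\<close>.\<close>

definition gap_prob :: "nat \<Rightarrow> nat set \<Rightarrow> nat set \<Rightarrow> nat \<Rightarrow> real" where
  "gap_prob k A B d = (\<Prod>i\<le>d. pair_prob k A B i (d - i))"

lemma gap_prob_known:
  assumes "d < k"
  shows "gap_prob k A B d = of_bool (unrep A B d)"
proof -
  have eq: "pair_prob k A B i (d - i) = of_bool (i \<in> A \<longrightarrow> d - i \<notin> B)" if "i \<le> d" for i
    using assms that by (auto simp: pair_prob_def)
  have "gap_prob k A B d = (\<Prod>i\<le>d. of_bool (i \<in> A \<longrightarrow> d - i \<notin> B))"
    unfolding gap_prob_def by (intro prod.cong) (auto simp: eq)
  also have "\<dots> = of_bool (unrep A B d)"
    by (cases "unrep A B d") (auto simp: unrep_def intro!: prod.neutral)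
  finally show ?thesis .
qed

text \<open>Total probability for the two coins of \<open>k\<close>. They occur only in the factors
  \<open>i = k\<close> and \<open>i = d - k\<close>; these are one factor if
  \<open>d = 2 * k\<close>, and absent if \<open>d < k\<close>.\<close>

lemma gap_prob_step:
  assumes "A \<subseteq> {..<k}" "B \<subseteq> {..<k}"
  shows "gap_prob k A B d =
    (gap_prob (Suc k) A B d + gap_prob (Suc k) (insert k A) B d +
     gap_prob (Suc k) A (insert k B) d + gap_prob (Suc k) (insert k A) (insert k B) d) / 4"
proof -
  consider "d < k" | "d = 2 * k" | "k \<le> d" "d \<noteq> 2 * k" by linarith
  then show ?thesis
  proof cases
    case 1
    have "unrep (insert k A) B d = unrep A B d" "unrep A (insert k B) d = unrep A B d"
      "unrep (insert k A) (insert k B) d = unrep A B d"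
      using 1 by (auto simp: unrep_def)
    with 1 show ?thesis by (simp add: gap_prob_known)
  next
    case 2
    define R where "R = (\<Prod>i\<in>{..d} - {k}. pair_prob k A B i (d - i))"
    have k: "k \<notin> A" "k \<notin> B" using assms by auto
    have split: "gap_prob k' A' B' d = pair_prob k' A' B' k k * (\<Prod>i\<in>{..d} - {k}. pair_prob k' A' B' i (d - i))"
      for k' A' B'
      unfolding gap_prob_def by (subst prod.remove[of _ k]) (use 2 in \<open>simp_all add: mult_2\<close>)
    have rest: "(\<Prod>i\<in>{..d} - {k}. pair_prob (Suc k) A' B' i (d - i)) = R"
      if "A' = A \<or> A' = insert k A" "B' = B \<or> B' = insert k B" for A' B'
      unfolding R_def
    proof (rule prod.cong)
      fix i assume i: "i \<in> {..d} - {k}"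
      then have "i \<noteq> k" "d - i \<noteq> k" using 2 by auto
      then show "pair_prob (Suc k) A' B' i (d - i) = pair_prob k A B i (d - i)"
        using that by (auto simp: pair_prob_def less_Suc_eq)
    qed simp
    have "pair_prob k A B k k = 3/4" "pair_prob (Suc k) A B k k = 1"
      "pair_prob (Suc k) (insert k A) B k k = 1" "pair_prob (Suc k) A (insert k B) k k = 1"
      "pair_prob (Suc k) (insert k A) (insert k B) k k = 0"
      using k by (simp_all add: pair_prob_def)
    then show ?thesis
      by (simp add: split rest R_def[symmetric])
  next
    case 3
    define j where "j = d - k"
    define R where "R = (\<Prod>i\<in>{..d} - {k} - {j}. pair_prob k A B i (d - i))"
    have j: "j \<noteq> k" "j \<le> d" "d - k = j" "d - j = k" "k \<le> d" using 3 by (auto simp: j_def)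
    have k: "k \<notin> A" "k \<notin> B" using assms by auto
    have split: "gap_prob k' A' B' d = pair_prob k' A' B' k j * (pair_prob k' A' B' j k *
        (\<Prod>i\<in>{..d} - {k} - {j}. pair_prob k' A' B' i (d - i)))" for k' A' B'
      unfolding gap_prob_def
      apply (subst prod.remove[of _ k])
      using j apply simp_all
      apply (subst prod.remove[of _ j])
      using j by simp_all
    have rest: "(\<Prod>i\<in>{..d} - {k} - {j}. pair_prob (Suc k) A' B' i (d - i)) = R"
      if "A' = A \<or> A' = insert k A" "B' = B \<or> B' = insert k B" for A' B'
      unfolding R_def
    proof (rule prod.cong)
      fix i assume i: "i \<in> {..d} - {k} - {j}"
      then have "i \<noteq> k" "d - i \<noteq> k" using j by auto
      then show "pair_prob (Suc k) A' B' i (d - i) = pair_prob k A B i (d - i)"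
        using that by (auto simp: pair_prob_def less_Suc_eq)
    qed simp
    \<comment> \<open>Each coin of \<open>k\<close> occurs in one factor: that of \<open>A\<close>
      in the factor \<open>k\<close>, that of \<open>B\<close> in the factor
      \<open>j\<close>.\<close>
    have e: "pair_prob k A B k j = (pair_prob (Suc k) A B k j + pair_prob (Suc k) (insert k A) B k j) / 2"
      "pair_prob k A B j k = (pair_prob (Suc k) A B j k + pair_prob (Suc k) A (insert k B) j k) / 2"
      "pair_prob (Suc k) A' (insert k B) k j = pair_prob (Suc k) A' B k j"
      "pair_prob (Suc k) (insert k A) B' j k = pair_prob (Suc k) A B' j k" for A' B'
      using k j(1) by (auto simp: pair_prob_def less_Suc_eq)
    have "gap_prob k A B d = pair_prob k A B k j * (pair_prob k A B j k * R)"
      by (simp add: split R_def)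
    moreover have "gap_prob (Suc k) A' B' d = pair_prob (Suc k) A' B k j * (pair_prob (Suc k) A B' j k * R)"
      if "A' = A \<or> A' = insert k A" "B' = B \<or> B' = insert k B" for A' B'
      using that e(3,4) by (auto simp: split rest)
    ultimately show ?thesis
      unfolding e(1,2) by (simp add: algebra_simps add_divide_distrib)
  qed
qed

lemma expect_gap:
  assumes "A \<subseteq> {..<k}" "B \<subseteq> {..<k}" "d < k + n"
  shows "expect n k A B (\<lambda>A B. of_bool (unrep A B d)) = gap_prob k A B d"
  using assms
proof (induction n arbitrary: k A B)
  case 0
  then show ?case by (simp add: gap_prob_known)
next
  case (Suc n)
  have "expect n (Suc k) A1 B1 (\<lambda>A B. of_bool (unrep A B d)) = gap_prob (Suc k) A1 B1 d"
    if "A1 = A \<or> A1 = insert k A" "B1 = B \<or> B1 = insert k B" for A1 B1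
    by (rule Suc.IH) (use that Suc.prems in auto)
  then show ?case
    using gap_prob_step[OF Suc.prems(1,2), of d] by simp
qed

text \<open>Equals 1/2 to the power
  \<open>card (A \<inter> {..<i}) + card (B \<inter> {..<i})\<close>.\<close>

definition half_weight :: "nat set \<Rightarrow> nat set \<Rightarrow> nat \<Rightarrow> real" where
  "half_weight A B i = (\<Prod>j<i. (if j \<in> A then 1/2 else 1) * (if j \<in> B then 1/2 else 1))"

lemma half_weight_0 [simp]: "half_weight A B 0 = 1"
  by (simp add: half_weight_def)

lemma half_weight_Suc: "half_weight A B (Suc i) =
    half_weight A B i * ((if i \<in> A then 1/2 else 1) * (if i \<in> B then 1/2 else 1))"
  by (simp add: half_weight_def)

lemma half_weight_nonneg: "0 \<le> half_weight A B i"
  by (auto simp: half_weight_def intro!: prod_nonneg)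

lemma prod_reflect:
  fixes f :: "nat \<Rightarrow> 'a::comm_monoid_mult"
  assumes "m \<le> d"
  shows "(\<Prod>i\<in>{d - m..d}. f (d - i)) = (\<Prod>j\<le>m. f j)"
  by (rule prod.reindex_bij_witness[of _ "\<lambda>j. d - j" "\<lambda>i. d - i"]) (use assms in auto)

text \<open>Pairs with \<open>j \<le> i\<close> or \<open>j \<ge> k\<close> have one decided member,
  at most \<open>i\<close>, which costs 1/2 if present. The pairs in between are decided on both
  sides.\<close>

lemma gap_prob_near:
  assumes "A \<subseteq> {..<k}" "B \<subseteq> {..<k}" "i < k"
  shows "gap_prob k A B (k + i) = of_bool (unrep A B (k + i)) * half_weight A B (Suc i)"
proof -
  let ?f = "\<lambda>j. pair_prob k A B j (k + i - j)"
  have un: "{..k + i} = {..i} \<union> {Suc i..<k} \<union> {k..k + i}" using assms(3) by auto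
  have "gap_prob k A B (k + i) = prod ?f {..i} * prod ?f {Suc i..<k} * prod ?f {k..k + i}"
    unfolding gap_prob_def un using assms(3)
    by (subst prod.union_disjoint; (subst prod.union_disjoint)?) auto
  also have "prod ?f {..i} = (\<Prod>j<Suc i. if j \<in> A then 1/2 else 1)"
    using assms(3) by (auto simp: lessThan_Suc_atMost pair_prob_def intro!: prod.cong)
  also have "prod ?f {k..k + i} = (\<Prod>j\<in>{k + i - i..k + i}. if k + i - j \<in> B then 1/2 else 1)"
    using assms(3) by (auto simp: pair_prob_def intro!: prod.cong)
  also have "\<dots> = (\<Prod>j<Suc i. if j \<in> B then 1/2 else 1)"
    unfolding lessThan_Suc_atMost by (rule prod_reflect) simp
  also have "prod ?f {Suc i..<k} = (\<Prod>j\<in>{Suc i..<k}. of_bool (j \<in> A \<longrightarrow> k + i - j \<notin> B))"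
    using assms(3) by (auto simp: pair_prob_def intro!: prod.cong)
  also have "\<dots> = of_bool (\<forall>j\<in>{Suc i..<k}. j \<in> A \<longrightarrow> k + i - j \<notin> B)"
    by (cases "\<forall>j\<in>{Suc i..<k}. j \<in> A \<longrightarrow> k + i - j \<notin> B") (auto intro!: prod.neutral)
  also have "(\<forall>j\<in>{Suc i..<k}. j \<in> A \<longrightarrow> k + i - j \<notin> B) \<longleftrightarrow> unrep A B (k + i)"
  proof -
    have "j \<in> {Suc i..<k}" if "j \<in> A" "k + i - j \<in> B" "j \<le> k + i" for j
    proof -
      have "j < k" "k + i - j < k" using that assms(1,2) by auto
      then show ?thesis by auto
    qed
    then have "unrep A B (k + i)" if "\<forall>j\<in>{Suc i..<k}. j \<in> A \<longrightarrow> k + i - j \<notin> B"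
      using that unfolding unrep_def by blast
    moreover have "\<forall>j\<in>{Suc i..<k}. j \<in> A \<longrightarrow> k + i - j \<notin> B" if "unrep A B (k + i)"
      using that by (auto simp: unrep_def)
    ultimately show ?thesis by blast
  qed
  finally show ?thesis by (simp add: half_weight_def prod.distrib)
qed

text \<open>From \<open>2 * k\<close> on no pair is decided on both sides, and exactly the
  \<open>i + 1\<close> pairs with \<open>j\<close> in \<open>{k..k + i}\<close> are undecided on
  both.\<close>

lemma gap_prob_far:
  assumes "A \<subseteq> {..<k}" "B \<subseteq> {..<k}" "0 < k"
  shows "gap_prob k A B (2 * k + i) = half_weight A B k * (3/4) ^ Suc i"
proof -
  let ?d = "2 * k + i"
  let ?f = "\<lambda>j. pair_prob k A B j (?d - j)"
  have un: "{..?d} = {..<k} \<union> {k..k + i} \<union> {Suc (k + i)..?d}" by auto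
  have "gap_prob k A B ?d = prod ?f {..<k} * prod ?f {k..k + i} * prod ?f {Suc (k + i)..?d}"
    unfolding gap_prob_def un by (subst prod.union_disjoint; (subst prod.union_disjoint)?) auto
  also have "prod ?f {..<k} = (\<Prod>j<k. if j \<in> A then 1/2 else 1)"
    by (auto simp: pair_prob_def intro!: prod.cong)
  also have "prod ?f {k..k + i} = (\<Prod>j\<in>{k..k + i}. 3/4)"
    by (rule prod.cong) (auto simp: pair_prob_def)
  also have "\<dots> = (3/4) ^ Suc i" by simp
  also have "prod ?f {Suc (k + i)..?d} = (\<Prod>j\<in>{?d - (k - 1)..?d}. if ?d - j \<in> B then 1/2 else 1)"
    using assms(3) by (intro prod.cong) (auto simp: pair_prob_def)
  also have "\<dots> = (\<Prod>j\<le>k - 1. if j \<in> B then 1/2 else 1)"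
    by (rule prod_reflect) simp
  also have "{..k - 1} = {..<k}" using assms(3) by auto
  finally show ?thesis by (simp add: half_weight_def prod.distrib)
qed

text \<open>The geometric series \<open>3/4 + (3/4)^2 + ...\<close> is 3, which becomes the value of
  \<open>lam End\<close>.\<close>

lemma gap_prob_far_sum:
  assumes "A \<subseteq> {..<k}" "B \<subseteq> {..<k}" "0 < k"
  shows "(\<Sum>d\<in>{2 * k..<N}. gap_prob k A B d) \<le> 3 * half_weight A B k"
proof -
  have "(\<Sum>d\<in>{2 * k..<N}. gap_prob k A B d) = (\<Sum>i<N - 2 * k. gap_prob k A B (2 * k + i))"
    by (rule sum.reindex_bij_witness[of _ "\<lambda>i. 2 * k + i" "\<lambda>d. d - 2 * k"]) auto
  also have "\<dots> = half_weight A B k * (3/4) * (\<Sum>i<N - 2 * k. (3/4) ^ i)"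
    by (simp only: gap_prob_far[OF assms] sum_distrib_left power_Suc mult.assoc)
  also have "(\<Sum>i<N - 2 * k. (3/4) ^ i) = (4 * (1 - (3/4) ^ (N - 2 * k)) :: real)"
    by (simp add: sum_gp_strict)
  also have "half_weight A B k * (3/4) * (4 * (1 - (3/4) ^ (N - 2 * k))) \<le> half_weight A B k * (3/4) * (4 * 1)"
    by (intro mult_left_mono) (auto simp: half_weight_nonneg)
  finally show ?thesis by simp
qed

section \<open>Reduction to sets that contain 0\<close>

lemma sum_Pow_insert:
  fixes f :: "'a set \<Rightarrow> real"
  assumes "finite S" "x \<notin> S"
  shows "(\<Sum>A\<in>Pow (insert x S). f A) = (\<Sum>A\<in>Pow S. f A + f (insert x A))"
proof -
  have "inj_on (insert x) (Pow S)"
    using assms(2) by (auto simp: inj_on_def)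
  moreover have "Pow S \<inter> insert x ` Pow S = {}"
    using assms(2) by auto
  ultimately show ?thesis
    using assms(1) by (simp add: Pow_insert sum.union_disjoint sum.reindex sum.distrib)
qed

lemma expect_eq_sum:
  "expect n k A B f =
     (\<Sum>A'\<in>Pow {k..<k + n}. \<Sum>B'\<in>Pow {k..<k + n}. f (A \<union> A') (B \<union> B')) / 4 ^ n"
proof (induction n arbitrary: k A B)
  case (Suc n)
  have ins: "{k..<k + Suc n} = insert k {Suc k..<Suc k + n}" by auto
  show ?case
    unfolding ins
    by (simp add: Suc.IH sum_Pow_insert sum.distrib add_divide_distrib)
qed simp

lemma sum_Pow_Suc_image:
  fixes f :: "nat set \<Rightarrow> real"
  shows "(\<Sum>A\<in>Pow {1..<1 + n}. f A) = (\<Sum>A\<in>Pow {..<n}. f (Suc ` A))"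
proof -
  have "{1..<1 + n} = Suc ` {..<n}"
    by (simp add: image_Suc_lessThan atLeastLessThanSuc_atLeastAtMost)
  then have "Pow {1..<1 + n} = (`) Suc ` Pow {..<n}"
    by (auto simp: subset_image_iff)
  moreover have "inj_on ((`) Suc) (Pow {..<n})"
    by (meson inj_Suc inj_image_eq_iff inj_onI)
  ultimately show ?thesis by (simp add: sum.reindex)
qed

lemma unrep_Suc_image: "unrep (Suc ` A) B (Suc d) \<longleftrightarrow> unrep A B d" "unrep (Suc ` A) B 0"
proof -
  show "unrep (Suc ` A) B 0" by (auto simp: unrep_def)
  show "unrep (Suc ` A) B (Suc d) \<longleftrightarrow> unrep A B d"
  proof
    assume l: "unrep (Suc ` A) B (Suc d)"
    show "unrep A B d" unfolding unrep_def
    proof (intro allI impI)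
      fix i assume "i \<le> d" "i \<in> A"
      then show "d - i \<notin> B" using l[unfolded unrep_def, rule_format, of "Suc i"] by simp
    qed
  qed (auto simp: unrep_def)
qed

text \<open>The extra gap is 0, which a shifted set cannot represent; the other gaps move up by
  one.\<close>

lemma gaps_Suc_image: "gaps (Suc N) (Suc ` A) B = Suc (gaps N A B)"
proof -
  have "{d. d < Suc N \<and> unrep (Suc ` A) B d} = insert 0 (Suc ` {d. d < N \<and> unrep A B d})"
    by (auto simp: unrep_Suc_image image_iff less_Suc_eq_0_disj)
  then show ?thesis
    by (simp add: gaps_def card_image)
qed

lemma gaps_insert_right: "gaps N A (insert N B) = gaps N A B"
proof -
  have "unrep A (insert N B) d \<longleftrightarrow> unrep A B d" if "d < N" for d
    using that by (auto simp: unrep_def)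
  then have "{d. d < N \<and> unrep A (insert N B) d} = {d. d < N \<and> unrep A B d}" by blast
  then show ?thesis by (simp add: gaps_def)
qed

lemma unrep_commute: "unrep A B d \<longleftrightarrow> unrep B A d"
  unfolding unrep_def by (metis diff_diff_cancel diff_le_self)

lemma gaps_commute: "gaps N A B = gaps N B A"
  by (simp add: gaps_def unrep_commute)

lemma expect_commute:
  assumes "\<And>A B. f A B = f B A"
  shows "expect n k A B f = expect n k B A f"
  using assms by (induction n arbitrary: k A B) simp_all

definition gaps_expect :: "nat \<Rightarrow> (nat \<Rightarrow> real) \<Rightarrow> real" where
  "gaps_expect N \<phi> = expect N 0 {} {} (\<lambda>A B. \<phi> (gaps N A B))"

lemma gaps_expect_sum:
  "gaps_expect N \<phi> = (\<Sum>A\<in>Pow {..<N}. \<Sum>B\<in>Pow {..<N}. \<phi> (gaps N A B)) / 4 ^ N"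
  by (simp add: gaps_expect_def expect_eq_sum atLeast0LessThan)

text \<open>If 0 is absent from \<open>A\<close>, then \<open>A\<close> is a shifted uniform set.
  \<open>B\<close> then has one surplus coin, at \<open>N\<close>, without influence on the gaps
  below \<open>N\<close>. The factor 2 comes from adding two conditional means.\<close>

lemma expect_left_absent:
  "expect N 1 {} {} (\<lambda>A B. \<phi> (gaps (Suc N) A B)) + expect N 1 {} {0} (\<lambda>A B. \<phi> (gaps (Suc N) A B)) =
     2 * gaps_expect N (\<lambda>m. \<phi> (Suc m))"
proof -
  have "(\<Sum>B\<in>Pow {1..<1 + N}. g B + g ({0} \<union> B)) = (\<Sum>B\<in>Pow {..<Suc N}. g B)" for g :: "nat set \<Rightarrow> real"
  proof -
    have "{..<Suc N} = insert 0 {1..<1 + N}" by auto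
    then show ?thesis by (simp add: sum_Pow_insert)
  qed
  note low = this
  have "expect N 1 {} {} (\<lambda>A B. \<phi> (gaps (Suc N) A B)) + expect N 1 {} {0} (\<lambda>A B. \<phi> (gaps (Suc N) A B)) =
      (\<Sum>A\<in>Pow {1..<1 + N}. \<Sum>B\<in>Pow {1..<1 + N}. \<phi> (gaps (Suc N) A B) + \<phi> (gaps (Suc N) A ({0} \<union> B))) / 4 ^ N"
    by (simp add: expect_eq_sum add_divide_distrib sum.distrib)
  also have "\<dots> = (\<Sum>A\<in>Pow {1..<1 + N}. \<Sum>B\<in>Pow {..<Suc N}. \<phi> (gaps (Suc N) A B)) / 4 ^ N"
    by (intro arg_cong2[where f = "(/)"] sum.cong refl low)
  also have "\<dots> = (\<Sum>A\<in>Pow {..<N}. \<Sum>B\<in>Pow {..<Suc N}. \<phi> (Suc (gaps N A B))) / 4 ^ N"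
    by (simp only: sum_Pow_Suc_image gaps_Suc_image)
  also have "\<dots> = 2 * gaps_expect N (\<lambda>m. \<phi> (Suc m))"
    by (simp add: gaps_expect_sum lessThan_Suc sum_Pow_insert gaps_insert_right sum.distrib sum_distrib_left[symmetric])
  finally show ?thesis .
qed

lemma expect_both_absent:
  "expect (Suc N) 1 {} {} (\<lambda>A B. \<phi> (gaps (Suc (Suc N)) A B)) = gaps_expect N (\<lambda>m. \<phi> (Suc (Suc m)))"
proof -
  have g: "gaps (Suc (Suc N)) (Suc ` A) (Suc ` B) = Suc (Suc (gaps N A B))" for A B
    by (metis gaps_Suc_image gaps_commute)
  have gi: "gaps N (insert N A) B = gaps N A B" for A B
    by (metis gaps_insert_right gaps_commute)
  show ?thesis
    unfolding expect_eq_sum gaps_expect_sum sum_Pow_Suc_image Un_empty_left g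
    by (simp add: lessThan_Suc sum_Pow_insert gaps_insert_right gi sum.distrib sum_distrib_left[symmetric])
qed

text \<open>Inclusion-exclusion over the absence of 0 from \<open>A\<close> and from
  \<open>B\<close>: each event has probability 1/2 and, after a shift, contributes one gap; both
  together have probability 1/4 and contribute two.\<close>

lemma gaps_expect_recursion:
  "gaps_expect (Suc (Suc N)) \<phi> =
     expect (Suc N) 1 {0} {0} (\<lambda>A B. \<phi> (gaps (Suc (Suc N)) A B)) / 4 +
     gaps_expect (Suc N) (\<lambda>m. \<phi> (Suc m)) - gaps_expect N (\<lambda>m. \<phi> (Suc (Suc m))) / 4"
proof -
  let ?f = "\<lambda>A B. \<phi> (gaps (Suc (Suc N)) A B)"
  have "expect (Suc N) 1 {0} {} ?f = expect (Suc N) 1 {} {0} ?f"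
    by (rule expect_commute) (metis gaps_commute)
  moreover have "gaps_expect (Suc (Suc N)) \<phi> = (expect (Suc N) 1 {} {} ?f + expect (Suc N) 1 {0} {} ?f +
      expect (Suc N) 1 {} {0} ?f + expect (Suc N) 1 {0} {0} ?f) / 4"
    unfolding gaps_expect_def by (subst expect.simps(2)) simp
  ultimately show ?thesis
    using expect_left_absent[of "Suc N" \<phi>] expect_both_absent[of N \<phi>] by (simp add: field_simps)
qed

section \<open>Subsets that avoid pairs at a fixed distance\<close>

lemma sum_Pow_of_bool:
  assumes "finite V"
  shows "real (card {S \<in> Pow V. P S}) = (\<Sum>S\<in>Pow V. of_bool (P S))"
  using assms by (simp add: sum.If_cases of_bool_def Int_def)

text \<open>By \<open>x + e \<notin> T\<close> the pairs \<open>{x, x + e}\<close> are disjoint, so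
  each independently excludes one of its four membership patterns.\<close>

lemma card_avoid_pairs:
  fixes e :: int
  assumes "finite T" "finite V" "\<And>x. x \<in> T \<Longrightarrow> x \<in> V \<and> x + e \<in> V \<and> x + e \<notin> T" "e \<noteq> 0"
  shows "real (card {S \<in> Pow V. \<forall>x\<in>T. \<not> (x \<in> S \<and> x + e \<in> S)}) = (3/4) ^ card T * 2 ^ card V"
  using assms
proof (induction T arbitrary: V rule: finite_induct)
  case empty
  then show ?case by (simp add: card_Pow flip: Pow_def)
next
  case (insert x T)
  define V' where "V' = V - {x, x + e}"
  have V: "V = insert x (insert (x + e) V')" and new: "x \<notin> insert (x + e) V'" "x + e \<notin> V'" "finite V'"
    using insert.prems by (auto simp: V'_def)
  have T: "y \<noteq> x \<and> y \<noteq> x + e \<and> y + e \<noteq> x \<and> y + e \<noteq> x + e" if "y \<in> T" for y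
    using that insert.prems(2)[of x] insert.prems(2)[of y] insert.hyps by auto
  let ?Q = "\<lambda>S. \<forall>y\<in>T. \<not> (y \<in> S \<and> y + e \<in> S)"
  have "real (card {S \<in> Pow V. \<forall>y\<in>insert x T. \<not> (y \<in> S \<and> y + e \<in> S)}) =
      (\<Sum>S\<in>Pow V'. 3 * of_bool (?Q S))"
  proof -
    let ?P = "\<lambda>S. \<forall>y\<in>insert x T. \<not> (y \<in> S \<and> y + e \<in> S)"
    have "of_bool (?P S) + of_bool (?P (insert x S)) +
        (of_bool (?P (insert (x + e) S)) + of_bool (?P (insert x (insert (x + e) S)))) = 3 * (of_bool (?Q S) :: real)"
      if "S \<in> Pow V'" for S
    proof -
      have "x \<notin> S" "x + e \<notin> S" using new that by auto
      then have "?P S \<longleftrightarrow> ?Q S" "?P (insert x S) \<longleftrightarrow> ?Q S" "?P (insert (x + e) S) \<longleftrightarrow> ?Q S"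
        "\<not> ?P (insert x (insert (x + e) S))"
        using T \<open>e \<noteq> 0\<close> by auto
      then show ?thesis by simp
    qed
    note four = this
    have "real (card {S \<in> Pow V. ?P S}) = (\<Sum>S\<in>Pow (insert x (insert (x + e) V')). of_bool (?P S))"
      unfolding sum_Pow_of_bool[OF insert.prems(1)] V[symmetric] ..
    also have "\<dots> = (\<Sum>S\<in>Pow (insert (x + e) V'). of_bool (?P S) + of_bool (?P (insert x S)))"
      by (rule sum_Pow_insert) (use new in auto)
    also have "\<dots> = (\<Sum>S\<in>Pow V'. of_bool (?P S) + of_bool (?P (insert x S)) +
        (of_bool (?P (insert (x + e) S)) + of_bool (?P (insert x (insert (x + e) S)))))"
      by (rule sum_Pow_insert) (use new in auto)
    also have "\<dots> = (\<Sum>S\<in>Pow V'. 3 * of_bool (?Q S))"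
      by (rule sum.cong[OF refl four])
    finally show ?thesis .
  qed
  also have "\<dots> = 3 * real (card {S \<in> Pow V'. ?Q S})"
    unfolding sum_Pow_of_bool[OF new(3)] by (simp add: sum_distrib_left)
  also have "\<dots> = 3 * ((3/4) ^ card T * 2 ^ card V')"
  proof -
    have "y \<in> V' \<and> y + e \<in> V' \<and> y + e \<notin> T" if "y \<in> T" for y
      using T[OF that] insert.prems(2)[of y] that by (auto simp: V'_def)
    then show ?thesis using insert.IH[of V'] new(3) insert.prems(3) by simp
  qed
  also have "\<dots> = (3/4) ^ card (insert x T) * 2 ^ card V"
    using insert.hyps new V by simp
  finally show ?case .
qed

section \<open>Missing differences and gaps\<close>

lemma finite_difference_set: "finite S \<Longrightarrow> finite (difference_set S)"
proof -
  assume "finite S"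
  moreover have "difference_set S = (\<lambda>(x, y). x - y) ` (S \<times> S)"
    by (auto simp: difference_set_def)
  ultimately show ?thesis by simp
qed

lemma card_difference_set:
  assumes "finite S" "S \<noteq> {}"
  shows "card (difference_set S) = 1 + 2 * card (difference_set S \<inter> {0<..})"
proof -
  let ?P = "difference_set S \<inter> {0<..}"
  have sym: "- x \<in> difference_set S" if "x \<in> difference_set S" for x
    using that unfolding difference_set_def by force
  have "0 \<in> difference_set S" using assms(2) by (auto simp: difference_set_def)
  then have "difference_set S = insert 0 (?P \<union> uminus ` ?P)"
    using sym by (force simp: image_iff)
  moreover have "card (insert 0 (?P \<union> uminus ` ?P)) = 1 + 2 * card ?P"
  proof -
    have "finite ?P" using finite_difference_set[OF assms(1)] by simp
    moreover have "?P \<inter> uminus ` ?P = {}" by auto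
    moreover have "card (uminus ` ?P) = card ?P" by (intro card_image) (simp add: inj_on_def)
    ultimately show ?thesis by (subst card_insert_disjoint) (auto simp: card_Un_disjoint)
  qed
  ultimately show ?thesis by simp
qed

lemma missing_prob_eq:
  "missing_prob n k =
     real (card {S \<in> Pow {0..<int n}. 2 * int n - 1 - int (card (difference_set S)) = int k}) / 2 ^ n"
proof -
  have "finite (Pow {0..<int n})" "Pow {0..<int n} \<noteq> {}" by auto
  then show ?thesis
    unfolding missing_prob_def by (simp add: measure_pmf_of_set card_Pow Int_def)
qed

text \<open>Differences of a non-empty set come in pairs besides 0. The empty set misses
  \<open>2 * n - 1\<close>, which \<open>k < n\<close> rules out.\<close>

lemma missing_prob_odd:
  assumes "odd k" "k < n"
  shows "missing_prob n k = 0"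
proof -
  have "2 * int n - 1 - int (card (difference_set S)) \<noteq> int k" if "S \<subseteq> {0..<int n}" for S
  proof (cases "S = {}")
    case True
    then have "difference_set S = {}" by (simp add: difference_set_def)
    then show ?thesis using assms(2) by simp
  next
    case False
    have "finite S" using that finite_subset by blast
    then have "odd (int (card (difference_set S)))" using card_difference_set[of S] False by simp
    then have "even (2 * int n - 1 - int (card (difference_set S)))" by simp
    then show ?thesis using assms(1) by (metis even_of_nat)
  qed
  then have "{S \<in> Pow {0..<int n}. 2 * int n - 1 - int (card (difference_set S)) = int k} = {}"
    by blast
  then show ?thesis by (simp add: missing_prob_eq)
qed

definition left_part :: "nat \<Rightarrow> int set \<Rightarrow> nat set" where
  "left_part N S = {i. i < N \<and> int i \<in> S}"

definition right_part :: "nat \<Rightarrow> nat \<Rightarrow> int set \<Rightarrow> nat set" where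
  "right_part N n S = {i. i < N \<and> int n - 1 - int i \<in> S}"

text \<open>By \<open>2 * N \<le> n\<close> the two ends are disjoint, so a uniform \<open>S\<close>
  splits into an independent left end, reversed right end and middle.\<close>

lemma card_fringe:
  assumes "2 * N \<le> n"
  shows "real (card {S \<in> Pow {0..<int n}. gaps N (left_part N S) (right_part N n S) = j}) / 2 ^ n =
    gaps_expect N (\<lambda>m. of_bool (m = j))"
proof -
  let ?X = "{(A, B). A \<subseteq> {..<N} \<and> B \<subseteq> {..<N} \<and> gaps N A B = j}"
  let ?M = "{int N..<int n - int N}"
  let ?Y = "{S \<in> Pow {0..<int n}. gaps N (left_part N S) (right_part N n S) = j}"
  let ?f = "\<lambda>((A, B), C). int ` A \<union> (\<lambda>i. int n - 1 - int i) ` B \<union> C"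
  let ?g = "\<lambda>S. ((left_part N S, right_part N n S), S \<inter> ?M)"
  have fg: "?g (?f ((A, B), C)) = ((A, B), C)" if "A \<subseteq> {..<N}" "B \<subseteq> {..<N}" "C \<subseteq> ?M" for A B C
  proof -
    have "left_part N (?f ((A, B), C)) = A"
      using that assms by (force simp: left_part_def)
    moreover have "right_part N n (?f ((A, B), C)) = B"
      using that assms by (force simp: right_part_def)
    moreover have "?f ((A, B), C) \<inter> ?M = C"
      using that assms by force
    ultimately show ?thesis by simp
  qed
  have gf: "?f (?g S) = S" if "S \<subseteq> {0..<int n}" for S
  proof -
    have "x \<in> ?f (?g S)" if "x \<in> S" for x
    proof -
      have x: "0 \<le> x" "x < int n" using that \<open>S \<subseteq> {0..<int n}\<close> by auto
      consider "x < int N" | "x \<in> ?M" | "int n - int N \<le> x" by fastforce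
      then show ?thesis
      proof cases
        case 1
        then have "nat x \<in> left_part N S" using x that by (auto simp: left_part_def)
        then have "int (nat x) \<in> int ` left_part N S" by blast
        then show ?thesis using x by simp
      next
        case 2
        then show ?thesis using that by auto
      next
        case 3
        define i where "i = nat (int n - 1 - x)"
        have i: "x = int n - 1 - int i" using x by (simp add: i_def)
        then have "i \<in> right_part N n S" using x that 3 by (auto simp: right_part_def)
        then show ?thesis using i by (auto simp: image_iff)
      qed
    qed
    then have "S \<subseteq> ?f (?g S)" by blast
    moreover have "?f (?g S) \<subseteq> S" by (auto simp: left_part_def right_part_def)
    ultimately show ?thesis by blast
  qed
  have "bij_betw ?f (?X \<times> Pow ?M) ?Y"
  proof (rule bij_betw_byWitness[where f' = ?g])
    show "\<forall>p\<in>?X \<times> Pow ?M. ?g (?f p) = p"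
      using fg by auto
    show "\<forall>S\<in>?Y. ?f (?g S) = S" using gf by auto
    show "?f ` (?X \<times> Pow ?M) \<subseteq> ?Y"
    proof (rule image_subsetI)
      fix p assume "p \<in> ?X \<times> Pow ?M"
      then obtain A B C where p: "p = ((A, B), C)" and AB: "A \<subseteq> {..<N}" "B \<subseteq> {..<N}" "gaps N A B = j"
        and C: "C \<subseteq> ?M" by auto
      have "int ` A \<subseteq> {0..<int n}" "(\<lambda>i. int n - 1 - int i) ` B \<subseteq> {0..<int n}" "C \<subseteq> {0..<int n}"
        using AB C assms by force+
      then have "?f p \<subseteq> {0..<int n}" by (simp add: p)
      moreover have "gaps N (left_part N (?f p)) (right_part N n (?f p)) = j"
        using fg[OF AB(1,2) C] AB(3) by (simp add: p)
      ultimately show "?f p \<in> ?Y" by blast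
    qed
    show "?g ` ?Y \<subseteq> ?X \<times> Pow ?M"
      by (auto simp: left_part_def right_part_def)
  qed
  then have "card ?Y = card ?X * 2 ^ (n - 2 * N)"
  proof -
    have "card ?M = n - 2 * N" using assms by simp
    then show ?thesis
      using bij_betw_same_card[OF \<open>bij_betw ?f (?X \<times> Pow ?M) ?Y\<close>] by (simp add: card_cartesian_product card_Pow)
  qed
  moreover have "real (card ?X) = (\<Sum>A\<in>Pow {..<N}. \<Sum>B\<in>Pow {..<N}. of_bool (gaps N A B = j))"
  proof -
    have "?X = {p \<in> Pow {..<N} \<times> Pow {..<N}. gaps N (fst p) (snd p) = j}" by auto
    then have "real (card ?X) = (\<Sum>p\<in>Pow {..<N} \<times> Pow {..<N}. of_bool (gaps N (fst p) (snd p) = j))"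
      by (simp add: sum.If_cases of_bool_def Int_def)
    also have "\<dots> = (\<Sum>A\<in>Pow {..<N}. \<Sum>B\<in>Pow {..<N}. of_bool (gaps N A B = j))"
      unfolding sum.cartesian_product by (intro sum.cong) auto
    finally show ?thesis .
  qed
  moreover have "(2 :: real) ^ n = 4 ^ N * 2 ^ (n - 2 * N)"
  proof -
    have "(2 :: real) ^ n = 2 ^ (2 * N + (n - 2 * N))" using assms by simp
    then show ?thesis by (simp only: power_add power_mult) simp
  qed
  ultimately show ?thesis by (simp add: gaps_expect_sum)
qed

text \<open>If \<open>n - 1 - d = x - y\<close>, then \<open>y + (n - 1 - x) = d\<close>: such a
  difference is a representation of \<open>d\<close> as a sum of distances from the two ends. The
  factor 2 accounts for negative differences.\<close>

lemma missing_eq_gaps: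
  assumes "S \<subseteq> {0..<int n}" "2 * N + 2 \<le> n" "\<And>e. e \<in> {1..n - 1 - N} \<Longrightarrow> int e \<in> difference_set S"
  shows "2 * int n - 1 - int (card (difference_set S)) = 2 * int (gaps N (left_part N S) (right_part N n S))"
proof -
  let ?D = "difference_set S"
  \<comment> \<open>\<open>n - 1 - N \<ge> 1\<close>, so 1 is among the assumed differences; this
    excludes the empty set.\<close>
  have "int 1 \<in> ?D" by (rule assms(3)) (use assms(2) in auto)
  then have "S \<noteq> {}" by (auto simp: difference_set_def)
  have "finite S" using assms(1) finite_subset by blast
  have less: "x < int n" if "x \<in> ?D" for x
  proof -
    from that obtain u v where "x = u - v" "u \<in> S" "v \<in> S" by (auto simp: difference_set_def)
    moreover from this have "u < int n" "0 \<le> v" using assms(1) by auto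
    ultimately show ?thesis by linarith
  qed
  have mem: "int n - 1 - int d \<in> ?D \<longleftrightarrow> \<not> unrep (left_part N S) (right_part N n S) d" if "d < N" for d
  proof
    assume "int n - 1 - int d \<in> ?D"
    then obtain x y where xy: "x \<in> S" "y \<in> S" "int n - 1 - int d = x - y" by (auto simp: difference_set_def)
    then have "0 \<le> y" "x \<le> int n - 1" using assms(1) by auto
    then have "nat y \<le> d" "nat y \<in> left_part N S" "d - nat y \<in> right_part N n S"
      using xy that by (auto simp: left_part_def right_part_def algebra_simps of_nat_diff nat_le_iff)
    then show "\<not> unrep (left_part N S) (right_part N n S) d" by (auto simp: unrep_def)
  next
    assume "\<not> unrep (left_part N S) (right_part N n S) d"
    then obtain i where "i \<le> d" "int i \<in> S" "int n - 1 - int (d - i) \<in> S"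
      by (auto simp: unrep_def left_part_def right_part_def)
    then have "int n - 1 - int (d - i) - int i \<in> ?D" unfolding difference_set_def by blast
    moreover have "int n - 1 - int (d - i) - int i = int n - 1 - int d" using \<open>i \<le> d\<close> by simp
    ultimately show "int n - 1 - int d \<in> ?D" by (simp only:)
  qed
  have Q: "{1..int n - 1} - ?D = (\<lambda>d. int n - 1 - int d) ` {d. d < N \<and> unrep (left_part N S) (right_part N n S) d}"
  proof (intro equalityI subsetI)
    fix x assume x: "x \<in> {1..int n - 1} - ?D"
    define d where "d = nat (int n - 1 - x)"
    have d: "x = int n - 1 - int d" using x by (simp add: d_def)
    have "d < N"
    proof (rule ccontr)
      assume "\<not> d < N"
      then have "nat x \<in> {1..n - 1 - N}" using x d by auto
      from assms(3)[OF this] x show False by simp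
    qed
    then show "x \<in> (\<lambda>d. int n - 1 - int d) ` {d. d < N \<and> unrep (left_part N S) (right_part N n S) d}"
      using mem[of d] d x by auto
  next
    fix x assume "x \<in> (\<lambda>d. int n - 1 - int d) ` {d. d < N \<and> unrep (left_part N S) (right_part N n S) d}"
    then show "x \<in> {1..int n - 1} - ?D" using mem assms(2) by auto
  qed
  have "card ({1..int n - 1} - ?D) = gaps N (left_part N S) (right_part N n S)"
    unfolding Q gaps_def by (intro card_image) (auto simp: inj_on_def)
  moreover have "?D \<inter> {0<..} = {1..int n - 1} \<inter> ?D" using less by force
  moreover have "card ({1..int n - 1} \<inter> ?D) + card ({1..int n - 1} - ?D) = n - 1"
    using card_Int_Diff[of "{1..int n - 1}" ?D] by (simp add: nat_diff_distrib)
  ultimately show ?thesis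
    using card_difference_set[OF \<open>finite S\<close> \<open>S \<noteq> {}\<close>] assms(2) by simp
qed

section \<open>Differences away from the maximum are rarely absent\<close>

abbreviation "ratio \<equiv> sqrt (3/4)"

lemma ratio: "0 < ratio" "ratio < 1" "ratio\<^sup>2 = 3/4"
  by (auto intro: real_less_lsqrt)

text \<open>The pairs \<open>{x, x + e}\<close> overlap along progressions of step \<open>e\<close>.
  Those with \<open>x div e\<close> even are disjoint and, as \<open>x - e\<close> maps the odd ones
  to even ones injectively, at least half of all. Hence \<open>ratio\<close>, the root of 3/4, per
  pair.\<close>

lemma card_difference_absent:
  assumes "1 \<le> e" "e < n"
  shows "real (card {S \<in> Pow {0..<int n}. int e \<notin> difference_set S}) \<le> 2 ^ n * ratio ^ (n - e)"
proof -
  let ?U = "{x. x < n - e \<and> even (x div e)}" and ?O = "{x. x < n - e \<and> odd (x div e)}"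
  have "card ?O \<le> card ?U"
  proof (rule card_inj_on_le[where f = "\<lambda>x. x - e"])
    have ge: "e \<le> x" if "odd (x div e)" for x using that by (metis div_less even_zero not_le)
    show "inj_on (\<lambda>x. x - e) ?O" using ge by (auto simp: inj_on_def) (metis eq_diff_iff)
    have "even ((x - e) div e)" if "odd (x div e)" for x
      using that ge[OF that] assms(1) le_div_geq[of e x] by auto
    then show "(\<lambda>x. x - e) ` ?O \<subseteq> ?U" by auto
  qed simp
  moreover have "card (?U \<union> ?O) = card ?U + card ?O"
    by (rule card_Un_disjoint) auto
  moreover have "?U \<union> ?O = {..<n - e}" by auto
  ultimately have U: "n - e \<le> 2 * card ?U" by simp
  let ?T = "int ` ?U"
  have T: "card ?T = card ?U" by (intro card_image) auto
  have "{S \<in> Pow {0..<int n}. int e \<notin> difference_set S} \<subseteq>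
      {S \<in> Pow {0..<int n}. \<forall>x\<in>?T. \<not> (x \<in> S \<and> x + int e \<in> S)}"
  proof safe
    fix S x assume "int e \<notin> difference_set S" "int x \<in> S" "int x + int e \<in> S"
    moreover have "int e = (int x + int e) - int x" by simp
    ultimately show False unfolding difference_set_def by blast
  qed
  then have "real (card {S \<in> Pow {0..<int n}. int e \<notin> difference_set S}) \<le>
      real (card {S \<in> Pow {0..<int n}. \<forall>x\<in>?T. \<not> (x \<in> S \<and> x + int e \<in> S)})"
    by (intro of_nat_mono card_mono) auto
  also have "\<dots> = (3/4) ^ card ?T * 2 ^ card {0..<int n}"
  proof (rule card_avoid_pairs)
    fix x assume "x \<in> ?T"
    then obtain y where y: "x = int y" "y < n - e" "even (y div e)" by auto
    moreover have "odd ((y + e) div e)" using y assms(1) by simp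
    then have "x + int e \<notin> ?T" using y by (auto simp flip: of_nat_add)
    ultimately show "x \<in> {0..<int n} \<and> x + int e \<in> {0..<int n} \<and> x + int e \<notin> ?T" by auto
  qed (use assms in auto)
  also have "(3/4 :: real) ^ card ?T = ratio ^ (2 * card ?U)"
    unfolding T power_mult ratio(3) ..
  also have "\<dots> \<le> ratio ^ (n - e)"
    using U ratio(1,2) by (intro power_decreasing) auto
  finally show ?thesis by (simp add: mult.commute)
qed

text \<open>Outside \<open>?B\<close>, where a difference up to \<open>n - 1 - N\<close> is absent,
  the two ends determine the count. The union bound for \<open>?B\<close> is a geometric tail that
  does not depend on \<open>n\<close>.\<close>

lemma missing_prob_approx:
  assumes "2 * N + 2 \<le> n"
  shows "\<bar>missing_prob n (2 * j) - gaps_expect N (\<lambda>m. of_bool (m = j))\<bar> \<le> ratio ^ Suc N / (1 - ratio)"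
proof -
  let ?V = "Pow {0..<int n}"
  let ?X = "{S \<in> ?V. 2 * int n - 1 - int (card (difference_set S)) = int (2 * j)}"
  let ?Y = "{S \<in> ?V. gaps N (left_part N S) (right_part N n S) = j}"
  let ?B = "\<Union>e\<in>{1..n - 1 - N}. {S \<in> ?V. int e \<notin> difference_set S}"
  have good: "2 * int n - 1 - int (card (difference_set S)) = 2 * int (gaps N (left_part N S) (right_part N n S))"
    if "S \<in> ?V" "S \<notin> ?B" for S
    using that assms by (intro missing_eq_gaps) auto
  have eq: "S \<in> ?X \<longleftrightarrow> S \<in> ?Y" if "S \<in> ?V" "S \<notin> ?B" for S
  proof -
    have "2 * int (gaps N (left_part N S) (right_part N n S)) = int (2 * j) \<longleftrightarrow>
        gaps N (left_part N S) (right_part N n S) = j" by linarith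
    then show ?thesis using good[OF that] that(1) by simp
  qed
  have fin: "finite ?V" by simp
  have sub: "?X \<subseteq> ?Y \<union> ?B" "?Y \<subseteq> ?X \<union> ?B" using eq by blast+
  have "finite ?X" "finite ?Y" "finite ?B" using fin by (auto intro: finite_subset)
  then have "card ?X \<le> card (?Y \<union> ?B)" "card ?Y \<le> card (?X \<union> ?B)"
    using sub by (meson card_mono finite_UnI)+
  then have XY: "card ?X \<le> card ?Y + card ?B" "card ?Y \<le> card ?X + card ?B"
    using card_Un_le[of ?Y ?B] card_Un_le[of ?X ?B] by linarith+
  have "real (card ?B) \<le> (\<Sum>e\<in>{1..n - 1 - N}. real (card {S \<in> ?V. int e \<notin> difference_set S}))"
    unfolding of_nat_sum[symmetric] of_nat_le_iff by (rule card_UN_le) simp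
  also have "\<dots> \<le> (\<Sum>e\<in>{1..n - 1 - N}. 2 ^ n * ratio ^ (n - e))"
    using assms by (intro sum_mono card_difference_absent) auto
  also have "\<dots> = 2 ^ n * (\<Sum>m\<in>{Suc N..n - 1}. ratio ^ m)"
    unfolding sum_distrib_left
    by (rule sum.reindex_bij_witness[of _ "\<lambda>m. n - m" "\<lambda>e. n - e"]) (use assms in auto)
  also have "\<dots> \<le> 2 ^ n * (ratio ^ Suc N / (1 - ratio))"
  proof (rule mult_left_mono)
    have "(\<Sum>m\<in>{Suc N..n - 1}. ratio ^ m) = (ratio ^ Suc N - ratio ^ Suc (n - 1)) / (1 - ratio)"
      using assms ratio(2) by (subst sum_gp) auto
    also have "\<dots> \<le> ratio ^ Suc N / (1 - ratio)"
      using ratio(1,2) by (intro divide_right_mono) auto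
    finally show "(\<Sum>m\<in>{Suc N..n - 1}. ratio ^ m) \<le> ratio ^ Suc N / (1 - ratio)" .
  qed simp
  finally have B: "real (card ?B) / 2 ^ n \<le> ratio ^ Suc N / (1 - ratio)"
    by (simp add: field_simps)
  have "real (card ?X) / 2 ^ n \<le> real (card ?Y) / 2 ^ n + real (card ?B) / 2 ^ n"
    "real (card ?Y) / 2 ^ n \<le> real (card ?X) / 2 ^ n + real (card ?B) / 2 ^ n"
    unfolding add_divide_distrib[symmetric] of_nat_add[symmetric] using XY
    by (auto intro!: divide_right_mono)
  then show ?thesis
    using B missing_prob_eq[of n "2 * j"] card_fringe[of N n j] assms by linarith
qed

text \<open>All late values of \<open>x\<close> are within \<open>\<epsilon> N\<close> of the same
  number \<open>y N\<close>, so \<open>x\<close> is Cauchy.\<close>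

lemma convergent_of_approx:
  fixes x y \<epsilon> :: "nat \<Rightarrow> real"
  assumes "\<And>N n. 2 * N + 2 \<le> n \<Longrightarrow> \<bar>x n - y N\<bar> \<le> \<epsilon> N" "\<epsilon> \<longlonglongrightarrow> 0"
  shows "convergent x" "y \<longlonglongrightarrow> lim x"
proof -
  have "Cauchy x"
  proof (rule metric_CauchyI)
    fix r :: real assume "0 < r"
    then obtain N where N: "\<epsilon> N < r / 2"
      using order_tendstoD(2)[OF assms(2), of "r / 2"] by (auto simp: eventually_sequentially)
    have "dist (x m) (x n) < r" if "2 * N + 2 \<le> m" "2 * N + 2 \<le> n" for m n
      using assms(1)[OF that(1)] assms(1)[OF that(2)] N by (simp add: dist_real_def)
    then show "\<exists>M. \<forall>m\<ge>M. \<forall>n\<ge>M. dist (x m) (x n) < r" by blast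
  qed
  then show conv: "convergent x" by (simp add: Cauchy_convergent_iff)
  have "\<bar>lim x - y N\<bar> \<le> \<epsilon> N" for N
  proof (rule tendsto_upperbound)
    show "(\<lambda>n. \<bar>x n - y N\<bar>) \<longlonglongrightarrow> \<bar>lim x - y N\<bar>"
      using conv by (intro tendsto_intros) (simp add: convergent_LIMSEQ_iff)
    show "\<forall>\<^sub>F n in sequentially. \<bar>x n - y N\<bar> \<le> \<epsilon> N"
      by (rule eventually_mono[OF eventually_ge_at_top[of "2 * N + 2"] assms(1)])
  qed simp
  then have "(\<lambda>N. lim x - y N) \<longlonglongrightarrow> 0"
    by (intro tendsto_rabs_zero_cancel[OF tendsto_sandwich[OF _ _ tendsto_const assms(2)]]) auto
  from tendsto_diff[OF tendsto_const[of "lim x"] this] show "y \<longlonglongrightarrow> lim x" by simp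
qed

lemma
  shows missing_prob_convergent: "convergent (\<lambda>n. missing_prob n (2 * j))"
    and gaps_expect_tendsto: "(\<lambda>N. gaps_expect N (\<lambda>m. of_bool (m = j))) \<longlonglongrightarrow> ell (2 * j)"
proof -
  have "(\<lambda>N. ratio ^ Suc N / (1 - ratio)) \<longlonglongrightarrow> 0 / (1 - ratio)"
    using ratio by (intro tendsto_divide tendsto_const LIMSEQ_Suc LIMSEQ_realpow_zero) auto
  then have "(\<lambda>N. ratio ^ Suc N / (1 - ratio)) \<longlonglongrightarrow> 0" by simp
  from convergent_of_approx[OF missing_prob_approx this]
  show "convergent (\<lambda>n. missing_prob n (2 * j))"
    "(\<lambda>N. gaps_expect N (\<lambda>m. of_bool (m = j))) \<longlonglongrightarrow> ell (2 * j)"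
    unfolding ell_def by auto
qed

lemma missing_prob_convergent_all: "convergent (\<lambda>n. missing_prob n k)"
proof (cases "even k")
  case True
  then show ?thesis using missing_prob_convergent by (auto elim!: evenE)
next
  case False
  then have "\<forall>\<^sub>F n in sequentially. missing_prob n k = 0"
    by (intro eventually_mono[OF eventually_gt_at_top[of k]] missing_prob_odd)
  then have "(\<lambda>n. missing_prob n k) \<longlonglongrightarrow> 0" by (rule tendsto_eventually)
  then show ?thesis by (rule convergentI)
qed

section \<open>Profiles and leaf bounds\<close>

lemma unrep_restrict:
  assumes "A' \<inter> {..<k} = A" "B' \<inter> {..<k} = B" "d < k"
  shows "unrep A' B' d \<longleftrightarrow> unrep A B d"
proof -
  have "i \<in> A' \<longleftrightarrow> i \<in> A" "d - i \<in> B' \<longleftrightarrow> d - i \<in> B" if "i \<le> d" for i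
    using assms that by auto
  then show ?thesis unfolding unrep_def by blast
qed

lemma gaps_split:
  assumes "A' \<inter> {..<k} = A" "B' \<inter> {..<k} = B"
  shows "gaps (k + n) A' B' = gaps k A B + card {d \<in> {k..<k + n}. unrep A' B' d}"
proof -
  have eq: "{d. d < k + n \<and> unrep A' B' d} = {d. d < k \<and> unrep A B d} \<union> {d \<in> {k..<k + n}. unrep A' B' d}"
    using unrep_restrict[OF assms] by auto
  show ?thesis
    unfolding gaps_def eq by (rule card_Un_disjoint) auto
qed

text \<open>A profile records, for \<open>i < k\<close>, which of the two sets contain \<open>i\<close>, and whether \<open>k + i\<close> is
  already a sum of known elements (\<open>Cov\<close>) or not (\<open>Opn\<close>).\<close>

datatype side = No | Le | Ri | Bo
datatype profile = End | Cov side profile | Opn side profile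

definition side_of :: "side \<Rightarrow> nat \<Rightarrow> nat set \<Rightarrow> nat set \<Rightarrow> bool" where
  "side_of p i A B \<longleftrightarrow> (i \<in> A \<longleftrightarrow> p = Le \<or> p = Bo) \<and> (i \<in> B \<longleftrightarrow> p = Ri \<or> p = Bo)"

fun fits :: "profile \<Rightarrow> nat \<Rightarrow> nat \<Rightarrow> nat set \<Rightarrow> nat set \<Rightarrow> bool" where
  "fits End i k A B \<longleftrightarrow> i = k"
| "fits (Cov p r) i k A B \<longleftrightarrow>
     i < k \<and> side_of p i A B \<and> \<not> unrep A B (k + i) \<and> fits r (Suc i) k A B"
| "fits (Opn p r) i k A B \<longleftrightarrow>
     i < k \<and> side_of p i A B \<and> unrep A B (k + i) \<and> fits r (Suc i) k A B"

fun weight :: "side \<Rightarrow> real" where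
  "weight No = 1" | "weight Le = 1/2" | "weight Ri = 1/2" | "weight Bo = 1/4"

text \<open>Horner form of the sum of the gap probabilities from \<open>k\<close> on, with 3 for the
  tail from \<open>2 * k\<close>.\<close>

fun lam :: "profile \<Rightarrow> real" where
  "lam End = 3" | "lam (Cov p r) = weight p * lam r" | "lam (Opn p r) = weight p * (1 + lam r)"

text \<open>The gap probability of the first open position; without one below \<open>2 * k\<close>,
  the trivial bound 0.\<close>

fun mu :: "profile \<Rightarrow> real" where
  "mu End = 0" | "mu (Cov p r) = weight p * mu r" | "mu (Opn p r) = weight p"

lemma half_weight_side: "side_of p i A B \<Longrightarrow> half_weight A B (Suc i) = half_weight A B i * weight p"
  by (cases p) (auto simp: half_weight_Suc side_of_def)

lemma gap_sum_le_lam: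
  assumes "A \<subseteq> {..<k}" "B \<subseteq> {..<k}" "0 < k" "fits z i k A B" "2 * k \<le> N"
  shows "(\<Sum>d\<in>{k + i..<N}. gap_prob k A B d) \<le> half_weight A B i * lam z"
  using assms(4)
proof (induction z arbitrary: i)
  case End
  then show ?case using gap_prob_far_sum[OF assms(1-3), of N] by (simp add: mult_2)
next
  case (Cov p r)
  have "(\<Sum>d\<in>{k + i..<N}. gap_prob k A B d) =
      gap_prob k A B (k + i) + (\<Sum>d\<in>{k + Suc i..<N}. gap_prob k A B d)"
    using Cov.prems assms(5) by (simp add: sum.atLeast_Suc_lessThan)
  with Cov.IH[of "Suc i"] Cov.prems gap_prob_near[OF assms(1,2), of i] half_weight_side[of p i A B]
  show ?case by simp
next
  case (Opn p r)
  have "(\<Sum>d\<in>{k + i..<N}. gap_prob k A B d) =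
      gap_prob k A B (k + i) + (\<Sum>d\<in>{k + Suc i..<N}. gap_prob k A B d)"
    using Opn.prems assms(5) by (simp add: sum.atLeast_Suc_lessThan)
  with Opn.IH[of "Suc i"] Opn.prems gap_prob_near[OF assms(1,2), of i] half_weight_side[of p i A B]
  show ?case by (simp add: algebra_simps)
qed

lemma mu_witness:
  assumes "A \<subseteq> {..<k}" "B \<subseteq> {..<k}" "fits z i k A B"
  shows "mu z = 0 \<or> (\<exists>d. k \<le> d \<and> d < 2 * k \<and> half_weight A B i * mu z = gap_prob k A B d)"
  using assms(3)
proof (induction z arbitrary: i)
  case (Cov p r)
  then show ?case using Cov.IH[of "Suc i"] half_weight_side[of p i A B] by (auto simp: mult.assoc)
next
  case (Opn p r)
  then show ?case
    using gap_prob_near[OF assms(1,2), of i] half_weight_side[of p i A B]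
    by (intro disjI2 exI[of _ "k + i"]) auto
qed auto

text \<open>The signs of \<open>b\<close> and \<open>s\<close> fit the available estimates:
  \<open>mu\<close> is a lower bound of a probability, \<open>lam\<close> an upper bound of a
  mean.\<close>

locale minorant =
  fixes h a b s :: "nat \<Rightarrow> real"
  assumes minorant: "a c + b c * of_bool (0 < x) - s c * real x \<le> h (c + x)"
    and b_nonneg: "0 \<le> b c" and s_nonneg: "0 \<le> s c"
begin

text \<open>Linearity of expectation. \<open>k \<le> n\<close> puts all positions of the profile, up
  to \<open>2 * k - 1\<close>, below the cutoff \<open>k + n\<close>.\<close>

lemma leaf_bound:
  assumes "A \<subseteq> {..<k}" "B \<subseteq> {..<k}" "0 < k" "fits z 0 k A B" "k \<le> n"
  defines "c \<equiv> gaps k A B"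
  shows "a c + b c * mu z - s c * lam z \<le> expect n k A B (\<lambda>A B. h (gaps (k + n) A B))"
proof -
  let ?X = "\<lambda>A B. card {d \<in> {k..<k + n}. unrep A B d}"
  have X: "real (?X A' B') = (\<Sum>d\<in>{k..<k + n}. of_bool (unrep A' B' d))" for A' B'
    by (simp add: sum.If_cases of_bool_def Int_def)
  have mu: "mu z \<le> expect n k A B (\<lambda>A B. of_bool (0 < ?X A B))"
    using mu_witness[OF assms(1,2,4)]
  proof
    assume "mu z = 0"
    moreover have "expect n k A B (\<lambda>A B. 0) \<le> expect n k A B (\<lambda>A B. of_bool (0 < ?X A B))"
      by (rule expect_mono) (use assms in auto)
    ultimately show ?thesis by simp
  next
    assume "\<exists>d. k \<le> d \<and> d < 2 * k \<and> half_weight A B 0 * mu z = gap_prob k A B d"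
    then obtain d where d: "k \<le> d" "d < 2 * k" "mu z = gap_prob k A B d" by auto
    have "mu z = expect n k A B (\<lambda>A B. of_bool (unrep A B d))"
      using expect_gap[OF assms(1,2), of d n] d assms(5) by simp
    also have "\<dots> \<le> expect n k A B (\<lambda>A B. of_bool (0 < ?X A B))"
    proof (rule expect_mono)
      fix A' B'
      show "of_bool (unrep A' B' d) \<le> (of_bool (0 < ?X A' B') :: real)"
        using d assms(5) by (auto simp: card_gt_0_iff intro!: exI[of _ d])
    qed (use assms in auto)
    finally show ?thesis .
  qed
  have lam: "expect n k A B (\<lambda>A B. real (?X A B)) \<le> lam z"
  proof -
    have "expect n k A B (\<lambda>A B. real (?X A B)) = (\<Sum>d\<in>{k..<k + n}. gap_prob k A B d)"
      unfolding X expect_sum by (intro sum.cong) (use expect_gap[OF assms(1,2)] in auto)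
    also have "\<dots> \<le> lam z"
      using gap_sum_le_lam[OF assms(1-4), of "k + n"] assms(5) by simp
    finally show ?thesis .
  qed
  have "a c + b c * mu z - s c * lam z \<le>
      a c + (b c * expect n k A B (\<lambda>A B. of_bool (0 < ?X A B)) + (- s c) * expect n k A B (\<lambda>A B. real (?X A B)))"
    using mult_left_mono[OF mu b_nonneg[of c]] mult_left_mono[OF lam s_nonneg[of c]] by simp
  also have "\<dots> = expect n k A B (\<lambda>A B. a c + (b c * of_bool (0 < ?X A B) + (- s c) * real (?X A B)))"
    by (simp only: expect_add expect_scale expect_const)
  also have "\<dots> \<le> expect n k A B (\<lambda>A B. h (gaps (k + n) A B))"
  proof (rule expect_mono)
    fix A' B' assume "A' \<inter> {..<k} = A" "B' \<inter> {..<k} = B"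
    from gaps_split[OF this, of n] minorant[of c "?X A' B'"]
    show "a c + (b c * of_bool (0 < ?X A' B') + (- s c) * real (?X A' B')) \<le> h (gaps (k + n) A' B')"
      by (simp add: c_def)
  qed (use assms in auto)
  finally show ?thesis .
qed

end

text \<open>Decides the number \<open>k\<close> with side \<open>s\<close>. Statuses are relative to
  the depth, so they move one entry forward while sides stay: the entry with side \<open>p\<close>
  inherits the status of its successor, which becomes \<open>Cov\<close> if \<open>k\<close> in one
  set meets that successor in the other. At the end, \<open>2 * k\<close> is covered only for
  \<open>s = Bo\<close>, and \<open>2 * k + 1\<close> is always open.\<close>

fun ext :: "side \<Rightarrow> side \<Rightarrow> profile \<Rightarrow> profile" where
  "ext s p (Cov q r) = Cov p (ext s q r)"
| "ext No p (Opn q r) = Opn p (ext No q r)"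
| "ext Le p (Opn No r) = Opn p (ext Le No r)"
| "ext Le p (Opn Le r) = Opn p (ext Le Le r)"
| "ext Le p (Opn Ri r) = Cov p (ext Le Ri r)"
| "ext Le p (Opn Bo r) = Cov p (ext Le Bo r)"
| "ext Ri p (Opn No r) = Opn p (ext Ri No r)"
| "ext Ri p (Opn Le r) = Cov p (ext Ri Le r)"
| "ext Ri p (Opn Ri r) = Opn p (ext Ri Ri r)"
| "ext Ri p (Opn Bo r) = Cov p (ext Ri Bo r)"
| "ext Bo p (Opn No r) = Opn p (ext Bo No r)"
| "ext Bo p (Opn Le r) = Cov p (ext Bo Le r)"
| "ext Bo p (Opn Ri r) = Cov p (ext Bo Ri r)"
| "ext Bo p (Opn Bo r) = Cov p (ext Bo Bo r)"
| "ext No p End = Opn p (Opn No End)"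
| "ext Le p End = Opn p (Opn Le End)"
| "ext Ri p End = Opn p (Opn Ri End)"
| "ext Bo p End = Cov p (Opn Bo End)"

definition addA :: "side \<Rightarrow> nat \<Rightarrow> nat set \<Rightarrow> nat set" where
  "addA s k A = (if s = Le \<or> s = Bo then insert k A else A)"

definition addB :: "side \<Rightarrow> nat \<Rightarrow> nat set \<Rightarrow> nat set" where
  "addB s k B = (if s = Ri \<or> s = Bo then insert k B else B)"

text \<open>The only new pairs with sum \<open>k + i\<close> are \<open>(k, i)\<close> and
  \<open>(i, k)\<close>.\<close>

lemma unrep_add:
  assumes "A \<subseteq> {..<k}" "B \<subseteq> {..<k}" "i < k"
  shows "unrep (addA s k A) (addB s k B) (k + i) \<longleftrightarrow>
    unrep A B (k + i) \<and> ((s = Le \<or> s = Bo) \<longrightarrow> i \<notin> B) \<and> ((s = Ri \<or> s = Bo) \<longrightarrow> i \<notin> A)"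
proof -
  have kA: "k \<notin> A" "k \<notin> B" using assms by auto
  have "j \<in> addA s k A \<and> k + i - j \<in> addB s k B \<longleftrightarrow>
      j \<in> A \<and> k + i - j \<in> B \<or> j = k \<and> (s = Le \<or> s = Bo) \<and> i \<in> B \<or> j = i \<and> (s = Ri \<or> s = Bo) \<and> i \<in> A"
    if "j \<le> k + i" for j
  proof -
    have "k + i - j = k \<longleftrightarrow> j = i" "k + i - k = i" using that by auto
    then show ?thesis using assms(3) kA by (auto simp: addA_def addB_def)
  qed
  then have "(\<exists>j\<le>k + i. j \<in> addA s k A \<and> k + i - j \<in> addB s k B) \<longleftrightarrow>
      (\<exists>j\<le>k + i. j \<in> A \<and> k + i - j \<in> B) \<or> ((s = Le \<or> s = Bo) \<and> i \<in> B) \<or> ((s = Ri \<or> s = Bo) \<and> i \<in> A)"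
    using le_add1[of k i] le_add2[of i k] by blast
  then show ?thesis unfolding unrep_def by blast
qed

lemma unrep_top:
  assumes "A \<subseteq> {..<k}" "B \<subseteq> {..<k}"
  shows "unrep (addA s k A) (addB s k B) (k + k) \<longleftrightarrow> s \<noteq> Bo"
    and "unrep (addA s k A) (addB s k B) (Suc (k + k))"
proof -
  have le: "j \<le> k" if "j \<in> addA s k A \<or> j \<in> addB s k B" for j
    using that assms by (auto simp: addA_def addB_def split: if_splits)
  have "j = k" if "j \<in> addA s k A" "k + k - j \<in> addB s k B" for j
    using le[of j] le[of "k + k - j"] that by auto
  then have "unrep (addA s k A) (addB s k B) (k + k) \<longleftrightarrow> \<not> (k \<in> addA s k A \<and> k \<in> addB s k B)"
    unfolding unrep_def by (metis add_diff_cancel_left' le_add1)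
  also have "\<dots> \<longleftrightarrow> s \<noteq> Bo"
    using assms by (cases s) (auto simp: addA_def addB_def)
  finally show "unrep (addA s k A) (addB s k B) (k + k) \<longleftrightarrow> s \<noteq> Bo" .
  show "unrep (addA s k A) (addB s k B) (Suc (k + k))"
    unfolding unrep_def
  proof (intro allI impI notI)
    fix j assume "j \<in> addA s k A" "Suc (k + k) - j \<in> addB s k B"
    then show False using le[of j] le[of "Suc (k + k) - j"] by auto
  qed
qed

lemma fits_ext:
  assumes "A \<subseteq> {..<k}" "B \<subseteq> {..<k}" "i < k" "side_of p i A B" "fits r (Suc i) k A B"
  shows "fits (ext s p r) i (Suc k) (addA s k A) (addB s k B)"
  using assms(3-5)
proof (induction r arbitrary: p i)
  case End
  then have k: "k = Suc i" by simp
  have "side_of p i (addA s k A) (addB s k B)" "side_of s k (addA s k A) (addB s k B)"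
    using End assms(1,2) by (auto simp: side_of_def addA_def addB_def)
  then show ?case
    using unrep_top[OF assms(1,2), of s] k by (cases s) (auto simp: add.commute)
next
  case (Cov q r)
  have "side_of p i (addA s k A) (addB s k B)"
    using Cov.prems by (auto simp: side_of_def addA_def addB_def)
  moreover have "\<not> unrep (addA s k A) (addB s k B) (k + Suc i)"
    using Cov.prems unrep_add[OF assms(1,2), of "Suc i" s] by auto
  ultimately show ?case using Cov by auto
next
  case (Opn q r)
  have "side_of p i (addA s k A) (addB s k B)"
    using Opn.prems by (auto simp: side_of_def addA_def addB_def)
  moreover have "unrep (addA s k A) (addB s k B) (k + Suc i) \<longleftrightarrow>
      ((s = Le \<or> s = Bo) \<longrightarrow> Suc i \<notin> B) \<and> ((s = Ri \<or> s = Bo) \<longrightarrow> Suc i \<notin> A)"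
    using Opn.prems unrep_add[OF assms(1,2), of "Suc i" s] by auto
  moreover have "side_of q (Suc i) A B" using Opn.prems by simp
  moreover have "fits (ext s q r) (Suc i) (Suc k) (addA s k A) (addB s k B)"
    using Opn by auto
  ultimately show ?case using Opn.prems(1)
    by (cases s; cases q) (simp_all add: side_of_def)
qed

text \<open>Tables of counters for the leaves of the case tree: \<open>TC\<close> separates the depths, \<open>RC\<close> the
  numbers of gaps below the depth, and \<open>CC\<close> the exponents of \<open>1/2\<close>. The three binary counters (least
  significant bit first) count first open positions, other open positions, and leaves.\<close>

datatype bin = BZ | B0 bin | B1 bin
datatype cells = CE | CC bin bin bin cells
datatype row = RE | RC cells row
datatype table = TE | TC row table

fun inc :: "bin \<Rightarrow> bin" where
  "inc BZ = B1 BZ" | "inc (B0 x) = B1 x" | "inc (B1 x) = B0 (inc x)"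

fun counter :: "bin \<Rightarrow> real" where
  "counter BZ = 0" | "counter (B0 x) = 2 * counter x" | "counter (B1 x) = 1 + 2 * counter x"

lemma counter_inc: "counter (inc x) = counter x + 1"
  by (induction x) auto

text \<open>A termination measure: below, \<open>Bo\<close> is reduced to \<open>Le\<close>, and an
  open \<open>Le\<close> or \<open>Ri\<close> to \<open>No\<close>, before the entry is
  dropped.\<close>

fun bits :: "profile \<Rightarrow> nat" where
  "bits End = 0"
| "bits (Cov p r) = (case p of No \<Rightarrow> 1 | Bo \<Rightarrow> 3 | _ \<Rightarrow> 2) + bits r"
| "bits (Opn p r) = (case p of No \<Rightarrow> 1 | Bo \<Rightarrow> 3 | _ \<Rightarrow> 2) + bits r"

text \<open>Walks along profile and cells together, one cell per factor 1/2, hence two for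
  \<open>Bo\<close>. An open position is counted after the factor of its own side, as
  \<open>Opn No\<close>.\<close>

function leaf2 :: "profile \<Rightarrow> cells \<Rightarrow> cells" where
  "leaf2 (Cov No r) cs = leaf2 r cs"
| "leaf2 (Cov Le r) (CC x y w cs) = CC x y w (leaf2 r cs)"
| "leaf2 (Cov Le r) CE = CC BZ BZ BZ (leaf2 r CE)"
| "leaf2 (Cov Ri r) (CC x y w cs) = CC x y w (leaf2 r cs)"
| "leaf2 (Cov Ri r) CE = CC BZ BZ BZ (leaf2 r CE)"
| "leaf2 (Cov Bo r) (CC x y w cs) = CC x y w (leaf2 (Cov Le r) cs)"
| "leaf2 (Cov Bo r) CE = CC BZ BZ BZ (leaf2 (Cov Le r) CE)"
| "leaf2 (Opn Le r) (CC x y w cs) = CC x y w (leaf2 (Opn No r) cs)"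
| "leaf2 (Opn Le r) CE = CC BZ BZ BZ (leaf2 (Opn No r) CE)"
| "leaf2 (Opn Ri r) (CC x y w cs) = CC x y w (leaf2 (Opn No r) cs)"
| "leaf2 (Opn Ri r) CE = CC BZ BZ BZ (leaf2 (Opn No r) CE)"
| "leaf2 (Opn Bo r) (CC x y w cs) = CC x y w (leaf2 (Opn Le r) cs)"
| "leaf2 (Opn Bo r) CE = CC BZ BZ BZ (leaf2 (Opn Le r) CE)"
| "leaf2 (Opn No r) (CC x y w cs) = leaf2 r (CC x (inc y) w cs)"
| "leaf2 (Opn No r) CE = leaf2 r (CC BZ (B1 BZ) BZ CE)"
| "leaf2 End (CC x y w cs) = CC x y (inc w) cs"
| "leaf2 End CE = CC BZ BZ (B1 BZ) CE"
  by pat_completeness auto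
termination by (relation "Wellfounded.measure (\<lambda>(z, _). bits z)") auto

text \<open>The same walk up to the first open position, which alone enters
  \<open>mu\<close>.\<close>

function leaf1 :: "profile \<Rightarrow> cells \<Rightarrow> cells" where
  "leaf1 (Cov No r) cs = leaf1 r cs"
| "leaf1 (Cov Le r) (CC x y w cs) = CC x y w (leaf1 r cs)"
| "leaf1 (Cov Le r) CE = CC BZ BZ BZ (leaf1 r CE)"
| "leaf1 (Cov Ri r) (CC x y w cs) = CC x y w (leaf1 r cs)"
| "leaf1 (Cov Ri r) CE = CC BZ BZ BZ (leaf1 r CE)"
| "leaf1 (Cov Bo r) (CC x y w cs) = CC x y w (leaf1 (Cov Le r) cs)"
| "leaf1 (Cov Bo r) CE = CC BZ BZ BZ (leaf1 (Cov Le r) CE)"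
| "leaf1 (Opn Le r) (CC x y w cs) = CC x y w (leaf1 (Opn No r) cs)"
| "leaf1 (Opn Le r) CE = CC BZ BZ BZ (leaf1 (Opn No r) CE)"
| "leaf1 (Opn Ri r) (CC x y w cs) = CC x y w (leaf1 (Opn No r) cs)"
| "leaf1 (Opn Ri r) CE = CC BZ BZ BZ (leaf1 (Opn No r) CE)"
| "leaf1 (Opn Bo r) (CC x y w cs) = CC x y w (leaf1 (Opn Le r) cs)"
| "leaf1 (Opn Bo r) CE = CC BZ BZ BZ (leaf1 (Opn Le r) CE)"
| "leaf1 (Opn No r) (CC x y w cs) = leaf2 r (CC (inc x) y w cs)"
| "leaf1 (Opn No r) CE = leaf2 r (CC (B1 BZ) BZ BZ CE)"
| "leaf1 End (CC x y w cs) = CC x y (inc w) cs"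
| "leaf1 End CE = CC BZ BZ (B1 BZ) CE"
  by pat_completeness auto
termination by (relation "Wellfounded.measure (\<lambda>(z, _). bits z)") auto

fun add_leaf :: "nat \<Rightarrow> profile \<Rightarrow> row \<Rightarrow> row" where
  "add_leaf 0 z (RC cs r) = RC (leaf1 z cs) r"
| "add_leaf 0 z RE = RC (leaf1 z CE) RE"
| "add_leaf (Suc c) z (RC cs r) = RC cs (add_leaf c z r)"
| "add_leaf (Suc c) z RE = RC CE (add_leaf c z RE)"

text \<open>Each leaf is counted once, in the cell of its full weight. So \<open>wsum\<close> does
  not halve, while \<open>lsum\<close> reuses the count for the tail 3.\<close>

fun wsum :: "cells \<Rightarrow> real" where
  "wsum CE = 0" | "wsum (CC x y w cs) = counter w + wsum cs"
fun msum :: "cells \<Rightarrow> real" where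
  "msum CE = 0" | "msum (CC x y w cs) = counter x + msum cs / 2"
fun lsum :: "cells \<Rightarrow> real" where
  "lsum CE = 0" | "lsum (CC x y w cs) = counter x + counter y + 3 * counter w + lsum cs / 2"

lemma leaf2_sums:
  "wsum (leaf2 z cs) = wsum cs + 1" "msum (leaf2 z cs) = msum cs" "lsum (leaf2 z cs) = lsum cs + lam z"
  by (induction z cs rule: leaf2.induct) (simp_all add: counter_inc field_simps)

lemma leaf1_sums:
  "wsum (leaf1 z cs) = wsum cs + 1" "msum (leaf1 z cs) = msum cs + mu z" "lsum (leaf1 z cs) = lsum cs + lam z"
  by (induction z cs rule: leaf1.induct) (simp_all add: leaf2_sums counter_inc field_simps)

text \<open>The node with fuel \<open>F\<close> is split further iff the second open position has exponent at most
  \<open>F\<close>; a further level costs two units of fuel, and a further gap costs the next entry of the list.\<close>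

fun dec2 :: "nat \<Rightarrow> profile \<Rightarrow> bool" where
  "dec2 F (Cov No r) = dec2 F r"
| "dec2 (Suc F) (Cov Le r) = dec2 F r"
| "dec2 0 (Cov Le r) = False"
| "dec2 (Suc F) (Cov Ri r) = dec2 F r"
| "dec2 0 (Cov Ri r) = False"
| "dec2 (Suc (Suc F)) (Cov Bo r) = dec2 F r"
| "dec2 (Suc 0) (Cov Bo r) = False"
| "dec2 0 (Cov Bo r) = False"
| "dec2 F (Opn No r) = True"
| "dec2 (Suc F) (Opn Le r) = True"
| "dec2 0 (Opn Le r) = False"
| "dec2 (Suc F) (Opn Ri r) = True"
| "dec2 0 (Opn Ri r) = False"
| "dec2 (Suc (Suc F)) (Opn Bo r) = True"
| "dec2 (Suc 0) (Opn Bo r) = False"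
| "dec2 0 (Opn Bo r) = False"
| "dec2 (Suc F) End = True"
| "dec2 0 End = False"

fun dec1 :: "nat \<Rightarrow> profile \<Rightarrow> bool" where
  "dec1 F (Cov No r) = dec1 F r"
| "dec1 (Suc F) (Cov Le r) = dec1 F r"
| "dec1 0 (Cov Le r) = False"
| "dec1 (Suc F) (Cov Ri r) = dec1 F r"
| "dec1 0 (Cov Ri r) = False"
| "dec1 (Suc (Suc F)) (Cov Bo r) = dec1 F r"
| "dec1 (Suc 0) (Cov Bo r) = False"
| "dec1 0 (Cov Bo r) = False"
| "dec1 F (Opn No r) = dec2 F r"
| "dec1 (Suc F) (Opn Le r) = dec2 F r"
| "dec1 0 (Opn Le r) = False"
| "dec1 (Suc F) (Opn Ri r) = dec2 F r"
| "dec1 0 (Opn Ri r) = False"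
| "dec1 (Suc (Suc F)) (Opn Bo r) = dec2 F r"
| "dec1 (Suc 0) (Opn Bo r) = False"
| "dec1 0 (Opn Bo r) = False"
| "dec1 (Suc F) End = True"
| "dec1 0 End = False"

fun drop_fuel :: "nat \<Rightarrow> nat \<Rightarrow> nat" where
  "drop_fuel 0 F = F" | "drop_fuel (Suc d) (Suc F) = drop_fuel d F" | "drop_fuel (Suc d) 0 = 0"

text \<open>An exhausted list gives fuel 0, which forces a leaf.\<close>

fun next_fuel :: "nat list \<Rightarrow> nat \<Rightarrow> nat" where
  "next_fuel [] F = 0" | "next_fuel (d # ds) F = drop_fuel d F"

lemma drop_fuel_le: "drop_fuel d F \<le> F"
  by (induction d F rule: drop_fuel.induct) auto

lemma next_fuel_le: "next_fuel ds F \<le> F"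
  by (cases ds) (auto simp: drop_fuel_le)

lemma next_fuel_less: "2 * next_fuel ds F < Suc (Suc (Suc (2 * F)))"
  using next_fuel_le[of ds F] by linarith

text \<open>The table is an accumulator: its head row collects the leaves of this depth, and the
  four children work on its tail, which \<open>table_value\<close> weights by 1/4.\<close>

function (sequential)
  node :: "nat \<Rightarrow> nat list \<Rightarrow> nat \<Rightarrow> profile \<Rightarrow> table \<Rightarrow> table" and
  branch :: "bool \<Rightarrow> nat \<Rightarrow> nat list \<Rightarrow> nat \<Rightarrow> profile \<Rightarrow> row \<Rightarrow> table \<Rightarrow> table" where
  "node F ds c z TE = branch (dec1 F z) F ds c z RE TE"
| "node F ds c z (TC rw t) = branch (dec1 F z) F ds c z rw t"
| "branch True (Suc (Suc F)) ds c (Cov p r) rw t =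
     TC rw (node F ds c (ext No p r) (node F ds c (ext Le p r)
       (node F ds c (ext Ri p r) (node F ds c (ext Bo p r) t))))"
| "branch True (Suc (Suc F)) ds c (Opn p r) rw t =
     TC rw (node (next_fuel ds F) (tl ds) (Suc c) (ext No p r) (node F ds c (ext Le p r)
       (node F ds c (ext Ri p r) (node F ds c (ext Bo p r) t))))"
| "branch _ F ds c z rw t = TC (add_leaf c z rw) t"
  by pat_completeness auto
termination
  by (relation "Wellfounded.measure (\<lambda>x. case x of Inl (F, _) \<Rightarrow> 2 * F + 1 | Inr (_, F, _) \<Rightarrow> 2 * F)")
    (auto simp: next_fuel_less)

text \<open>The only leaf case in the evaluation: 0 lies in both sets, so every profile starts with
  \<open>Bo\<close>, and then \<open>dec1\<close> is true only with fuel at least 2.\<close>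

lemma branch_False: "branch False F ds c z rw t = TC (add_leaf c z rw) t"
  by simp

section \<open>Soundness of the case tree\<close>

context minorant
begin

fun row_value :: "nat \<Rightarrow> row \<Rightarrow> real" where
  "row_value c RE = 0"
| "row_value c (RC cs r) = a c * wsum cs + b c * msum cs - s c * lsum cs + row_value (Suc c) r"

fun table_value :: "table \<Rightarrow> real" where
  "table_value TE = 0" | "table_value (TC rw t) = row_value 0 rw + table_value t / 4"

lemma row_value_add_leaf:
  "row_value e (add_leaf c z rw) =
     row_value e rw + (a (e + c) + b (e + c) * mu z - s (e + c) * lam z)"
  by (induction c z rw arbitrary: e rule: add_leaf.induct) (simp_all add: leaf1_sums ring_distribs)

end

lemma expect_Suc:
  "expect (Suc n) k A B f =
    (expect n (Suc k) (addA No k A) (addB No k B) f + expect n (Suc k) (addA Le k A) (addB Le k B) f +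
     expect n (Suc k) (addA Ri k A) (addB Ri k B) f + expect n (Suc k) (addA Bo k A) (addB Bo k B) f) / 4"
  by (simp add: addA_def addB_def)

lemma add_subset:
  assumes "A \<subseteq> {..<k}" "B \<subseteq> {..<k}"
  shows "addA s k A \<subseteq> {..<Suc k}" "addB s k B \<subseteq> {..<Suc k}"
    "addA s k A \<inter> {..<k} = A" "addB s k B \<inter> {..<k} = B"
  using assms by (auto simp: addA_def addB_def)

text \<open>As 0 is in both sets, \<open>k\<close> in either set represents itself; an open
  \<open>k\<close> becomes a gap exactly for \<open>s = No\<close>.\<close>

lemma gaps_add:
  assumes "A \<subseteq> {..<k}" "B \<subseteq> {..<k}" "0 \<in> A" "0 \<in> B"
  shows "gaps (Suc k) (addA s k A) (addB s k B) = gaps k A B + of_bool (unrep A B k \<and> s = No)"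
proof -
  have "0 < k" using assms by auto
  have "unrep (addA s k A) (addB s k B) k \<longleftrightarrow> unrep A B k \<and> s = No"
    using unrep_add[OF assms(1,2) \<open>0 < k\<close>, of s] assms(3,4) by (cases s) auto
  moreover have "{d \<in> {k..<k + 1}. P d} = (if P k then {k} else {})" for P
    by auto
  ultimately show ?thesis
    using gaps_split[of "addA s k A" k A "addB s k B" B 1] add_subset[OF assms(1,2), of s] by simp
qed

definition state :: "profile \<Rightarrow> nat \<Rightarrow> nat set \<Rightarrow> nat set \<Rightarrow> nat \<Rightarrow> bool" where
  "state z k A B c \<longleftrightarrow> A \<subseteq> {..<k} \<and> B \<subseteq> {..<k} \<and> 0 \<in> A \<and> 0 \<in> B \<and> fits z 0 k A B \<and> gaps k A B = c"

lemma state_child: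
  assumes "state z k A B c"
  shows "z = Cov p r \<Longrightarrow> state (ext s p r) (Suc k) (addA s k A) (addB s k B) c"
    and "z = Opn p r \<Longrightarrow> state (ext s p r) (Suc k) (addA s k A) (addB s k B) (if s = No then Suc c else c)"
proof -
  have A: "A \<subseteq> {..<k}" "B \<subseteq> {..<k}" and zero: "0 \<in> A" "0 \<in> B" and z: "fits z 0 k A B" and c: "gaps k A B = c"
    using assms by (auto simp: state_def)
  have "0 < k" using A zero by auto
  have zero': "0 \<in> addA s k A" "0 \<in> addB s k B" using zero by (auto simp: addA_def addB_def)
  show "state (ext s p r) (Suc k) (addA s k A) (addB s k B) c" if "z = Cov p r"
    using that z c add_subset[OF A, of s] zero' gaps_add[OF A zero, of s] fits_ext[OF A \<open>0 < k\<close>, of p r s]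
    by (simp add: state_def)
  show "state (ext s p r) (Suc k) (addA s k A) (addB s k B) (if s = No then Suc c else c)" if "z = Opn p r"
    using that z c add_subset[OF A, of s] zero' gaps_add[OF A zero, of s] fits_ext[OF A \<open>0 < k\<close>, of p r s]
    by (simp add: state_def)
qed

context minorant
begin

definition target :: "nat \<Rightarrow> nat set \<Rightarrow> nat set \<Rightarrow> real" where
  "target N A B = h (gaps N A B)"

lemma state_leaf_bound:
  assumes "state z k A B c" "k \<le> n"
  shows "a c + b c * mu z - s c * lam z \<le> expect n k A B (target (k + n))"
proof -
  have "0 < k" using assms(1) by (auto simp: state_def)
  then show ?thesis
    using leaf_bound[of A k B z n] assms by (auto simp: state_def target_def[abs_def])
qed

text \<open>A level raises \<open>k\<close> and lowers \<open>n\<close> by one but costs two units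
  of fuel, so \<open>k + 2 * F \<le> n\<close> persists and yields \<open>k \<le> n\<close> at the
  leaves.\<close>

lemma node_bound:
  assumes "state z k A B c" "k + 2 * F \<le> n"
  shows "table_value (node F ds c z t) \<le> table_value t + expect n k A B (target (k + n))"
  using assms
proof (induction F arbitrary: ds c z t k n A B rule: less_induct)
  case (less F)
  \<comment> \<open>The flag \<open>y\<close> is arbitrary: the splitting rule affects the precision
    of the bound, not its validity.\<close>
  have bound: "table_value (branch y F ds c z rw u) \<le>
      row_value 0 rw + table_value u / 4 + expect n k A B (target (k + n))" for y rw u
  proof -
    consider (leaf) "branch y F ds c z rw u = TC (add_leaf c z rw) u"
      | (cov) F' p r where "y" "F = Suc (Suc F')" "z = Cov p r"
      | (opn) F' p r where "y" "F = Suc (Suc F')" "z = Opn p r"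
      by (cases "(y, F, ds, c, z, rw, u)" rule: branch.cases) auto
    then show ?thesis
    proof cases
      case leaf
      then show ?thesis
        using state_leaf_bound[OF less.prems(1), of n] less.prems(2) by (simp add: row_value_add_leaf)
    next
      case cov
      obtain m where n: "n = Suc m" using less.prems(2) cov by (cases n) auto
      have child: "table_value (node F' ds c (ext s p r) v) \<le> table_value v +
          expect m (Suc k) (addA s k A) (addB s k B) (target (k + n))" for s v
        using less.IH[of F' "ext s p r" "Suc k" "addA s k A" "addB s k B" c m ds v]
          state_child(1)[OF less.prems(1) cov(3), of s] less.prems(2) cov n by simp
      show ?thesis
        using child[of Bo u] child[of Ri "node F' ds c (ext Bo p r) u"]
          child[of Le "node F' ds c (ext Ri p r) (node F' ds c (ext Bo p r) u)"]
          child[of No "node F' ds c (ext Le p r) (node F' ds c (ext Ri p r) (node F' ds c (ext Bo p r) u))"]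
        unfolding n expect_Suc using cov by (simp add: add_divide_distrib)
    next
      case opn
      obtain m where n: "n = Suc m" using less.prems(2) opn by (cases n) auto
      have child: "table_value (node G es (if s = No then Suc c else c) (ext s p r) v) \<le> table_value v +
          expect m (Suc k) (addA s k A) (addB s k B) (target (k + n))" if "G \<le> F'" for s v G es
        using less.IH[of G "ext s p r" "Suc k" "addA s k A" "addB s k B" "if s = No then Suc c else c" m es v]
          state_child(2)[OF less.prems(1) opn(3), of s] less.prems(2) opn n that by simp
      show ?thesis
        using child[OF order_refl, of ds Bo u] child[OF order_refl, of ds Ri "node F' ds c (ext Bo p r) u"]
          child[OF order_refl, of ds Le "node F' ds c (ext Ri p r) (node F' ds c (ext Bo p r) u)"]
          child[OF next_fuel_le[of ds], of "tl ds" No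
            "node F' ds c (ext Le p r) (node F' ds c (ext Ri p r) (node F' ds c (ext Bo p r) u))"]
        unfolding n expect_Suc using opn by (simp add: add_divide_distrib)
    qed
  qed
  show ?case
    using bound[of "dec1 F z" RE TE] bound[of "dec1 F z"] by (cases t) auto
qed

end

section \<open>Addition of tables and division of the case tree\<close>

fun add_bin :: "bin \<Rightarrow> bin \<Rightarrow> bin" where
  "add_bin BZ y = y"
| "add_bin x BZ = x"
| "add_bin (B0 x) (B0 y) = B0 (add_bin x y)"
| "add_bin (B0 x) (B1 y) = B1 (add_bin x y)"
| "add_bin (B1 x) (B0 y) = B1 (add_bin x y)"
| "add_bin (B1 x) (B1 y) = B0 (inc (add_bin x y))"

fun add_cells :: "cells \<Rightarrow> cells \<Rightarrow> cells" where
  "add_cells CE ds = ds"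
| "add_cells cs CE = cs"
| "add_cells (CC x y w cs) (CC x' y' w' ds) =
     CC (add_bin x x') (add_bin y y') (add_bin w w') (add_cells cs ds)"

fun add_row :: "row \<Rightarrow> row \<Rightarrow> row" where
  "add_row RE q = q"
| "add_row r RE = r"
| "add_row (RC cs r) (RC ds q) = RC (add_cells cs ds) (add_row r q)"

fun add_table :: "table \<Rightarrow> table \<Rightarrow> table" where
  "add_table TE u = u"
| "add_table t TE = t"
| "add_table (TC r t) (TC q u) = TC (add_row r q) (add_table t u)"

lemma counter_add: "counter (add_bin x y) = counter x + counter y"
  by (induction x y rule: add_bin.induct) (auto simp: counter_inc)

lemma sums_add:
  "wsum (add_cells cs ds) = wsum cs + wsum ds" "msum (add_cells cs ds) = msum cs + msum ds"
  "lsum (add_cells cs ds) = lsum cs + lsum ds"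
  by (induction cs ds rule: add_cells.induct) (auto simp: counter_add algebra_simps)

lemma (in minorant) row_value_add: "row_value c (add_row r q) = row_value c r + row_value c q"
  by (induction r q arbitrary: c rule: add_row.induct) (auto simp: sums_add algebra_simps)

lemma (in minorant) table_value_add: "table_value (add_table t u) = table_value t + table_value u"
  by (induction t u rule: add_table.induct) (auto simp: row_value_add add_divide_distrib)

text \<open>Rewriting is slow on large terms, so the first \<open>m\<close> levels add up the tables of the subtrees,
  and only the small subtrees below use a single table.\<close>

fun tree :: "nat \<Rightarrow> nat \<Rightarrow> nat list \<Rightarrow> nat \<Rightarrow> profile \<Rightarrow> table"
  and expand :: "bool \<Rightarrow> nat \<Rightarrow> nat \<Rightarrow> nat list \<Rightarrow> nat \<Rightarrow> profile \<Rightarrow> table" where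
  "tree 0 F ds c z = node F ds c z TE"
| "tree (Suc m) F ds c z = expand (dec1 F z) m F ds c z"
| "expand True m (Suc (Suc F)) ds c (Cov p r) =
     TC RE (add_table (tree m F ds c (ext No p r)) (add_table (tree m F ds c (ext Le p r))
       (add_table (tree m F ds c (ext Ri p r)) (tree m F ds c (ext Bo p r)))))"
| "expand True m (Suc (Suc F)) ds c (Opn p r) =
     TC RE (add_table (tree m (next_fuel ds F) (tl ds) (Suc c) (ext No p r)) (add_table (tree m F ds c (ext Le p r))
       (add_table (tree m F ds c (ext Ri p r)) (tree m F ds c (ext Bo p r)))))"
| "expand _ m F ds c z = TC (add_leaf c z RE) TE"

lemma expand_False: "expand False m F ds c z = TC (add_leaf c z RE) TE"
  by simp

text \<open>The subtree at the end of a prescribed path; each step adds a \<open>TC\<close>, that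
  is, a factor 1/4.\<close>

fun descend :: "side list \<Rightarrow> nat \<Rightarrow> nat \<Rightarrow> nat list \<Rightarrow> nat \<Rightarrow> profile \<Rightarrow> table" where
  "descend [] m F ds c z = tree m F ds c z"
| "descend (s # p) m F ds c (Cov q r) = TC RE (descend p m (drop_fuel (Suc (Suc 0)) F) ds c (ext s q r))"
| "descend (s # p) m F ds c (Opn q r) = TC RE
     (if s = No then descend p m (drop_fuel (Suc (Suc 0)) F) (tl ds) (Suc c) (ext s q r)
      else descend p m (drop_fuel (Suc (Suc 0)) F) ds c (ext s q r))"
| "descend (s # p) m F ds c End = TE"

fun run :: "nat \<Rightarrow> nat \<Rightarrow> nat list \<Rightarrow> side list list \<Rightarrow> table" where
  "run m F ds [] = TE"
| "run m F ds (p # ps) = add_table (descend p m F ds 0 (Opn Bo End)) (run m F ds ps)"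

context minorant
begin

lemma tree_bound:
  assumes "state z k A B c" "k + 2 * F \<le> n"
  shows "table_value (tree m F ds c z) \<le> expect n k A B (target (k + n))"
  using assms
proof (induction m arbitrary: F ds c z k n A B)
  case 0
  then show ?case using node_bound[of z k A B c F n ds TE] by simp
next
  case (Suc m)
  consider (leaf) "expand (dec1 F z) m F ds c z = TC (add_leaf c z RE) TE"
    | (cov) F' p r where "dec1 F z" "F = Suc (Suc F')" "z = Cov p r"
    | (opn) F' p r where "dec1 F z" "F = Suc (Suc F')" "z = Opn p r"
    by (cases "(dec1 F z, m, F, ds, c, z)" rule: expand.cases) auto
  then show ?case
  proof cases
    case leaf
    then show ?thesis
      using state_leaf_bound[OF Suc.prems(1), of n] Suc.prems(2) by (simp add: row_value_add_leaf)
  next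
    case cov
    obtain n' where n: "n = Suc n'" using Suc.prems(2) cov by (cases n) auto
    have "table_value (tree m F' ds c (ext s p r)) \<le>
        expect n' (Suc k) (addA s k A) (addB s k B) (target (k + n))" for s
      using Suc.IH[of "ext s p r" "Suc k" "addA s k A" "addB s k B" c F' n' ds]
        state_child(1)[OF Suc.prems(1) cov(3), of s] Suc.prems(2) cov n by simp
    from this[of No] this[of Le] this[of Ri] this[of Bo] show ?thesis
      unfolding n expect_Suc using cov by (simp add: table_value_add add_divide_distrib)
  next
    case opn
    obtain n' where n: "n = Suc n'" using Suc.prems(2) opn by (cases n) auto
    have child: "table_value (tree m G es (if s = No then Suc c else c) (ext s p r)) \<le>
        expect n' (Suc k) (addA s k A) (addB s k B) (target (k + n))" if "G \<le> F'" for s G es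
      using Suc.IH[of "ext s p r" "Suc k" "addA s k A" "addB s k B" "if s = No then Suc c else c" G n' es]
        state_child(2)[OF Suc.prems(1) opn(3), of s] Suc.prems(2) opn n that by simp
    from child[OF next_fuel_le[of ds], of "tl ds" No] child[OF order_refl, of ds Le]
      child[OF order_refl, of ds Ri] child[OF order_refl, of ds Bo] show ?thesis
      unfolding n expect_Suc using opn by (simp add: table_value_add add_divide_distrib)
  qed
qed

end

fun path_expect ::
    "side list \<Rightarrow> nat \<Rightarrow> nat \<Rightarrow> nat set \<Rightarrow> nat set \<Rightarrow> (nat set \<Rightarrow> nat set \<Rightarrow> real) \<Rightarrow> real" where
  "path_expect [] n k A B f = expect n k A B f"
| "path_expect (s # p) n k A B f = path_expect p (n - 1) (Suc k) (addA s k A) (addB s k B) f"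

text \<open>\<open>length p\<close> pays for the steps of the path, since \<open>drop_fuel\<close>
  stops at 0 and need not lower the fuel.\<close>

lemma (in minorant) descend_bound:
  assumes "state z k A B c" "k + 2 * (F + length p) \<le> n"
  shows "table_value (descend p m F ds c z) \<le> path_expect p n k A B (target (k + n)) / 4 ^ length p"
  using assms
proof (induction p m F ds c z arbitrary: k n A B rule: descend.induct)
  case (1 m F ds c z)
  then show ?case using tree_bound[of z k A B c F n m ds] by simp
next
  case (2 s p m F ds c q r)
  obtain n' where n: "n = Suc n'" using "2.prems"(2) by (cases n) auto
  show ?case
    using "2.IH"[of "Suc k" "addA s k A" "addB s k B" n'] state_child(1)[OF "2.prems"(1) refl, of s]
       "2.prems"(2) n drop_fuel_le[of "Suc (Suc 0)" F]
    by simp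
next
  case (3 s p m F ds c q r)
  obtain n' where n: "n = Suc n'" using "3.prems"(2) by (cases n) auto
  show ?case
    using "3.IH"[of "Suc k" "addA s k A" "addB s k B" n'] state_child(2)[OF "3.prems"(1) refl, of s]
      "3.prems"(2) n drop_fuel_le[of "Suc (Suc 0)" F]
    by (cases "s = No") simp_all
next
  case (4 s p m F ds c)
  then show ?case by (auto simp: state_def)
qed

text \<open>Exchanging the two sets pairs the branches \<open>Le\<close> and \<open>Ri\<close> of a node with \<open>A = B\<close>.\<close>

lemma expect_symmetric:
  assumes "\<And>A B. f A B = f B A"
  shows "expect (Suc n) k A A f =
    (expect n (Suc k) A A f + 2 * expect n (Suc k) (insert k A) A f +
     expect n (Suc k) (insert k A) (insert k A) f) / 4"
  using expect_commute[OF assms, of n "Suc k" A "insert k A"] by simp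

text \<open>The paths cut the tree at depth at most 3. Those counted twice leave
  \<open>A = B\<close> in their last step by \<open>Le\<close>, standing also for \<open>Ri\<close>;
  those counted once keep \<open>A = B\<close>.\<close>

definition "twice_paths1 = [[Le]]"

definition "twice_paths2 = [[No, Le], [Bo, Le], [No, No, Le], [No, Bo, Le], [Bo, No, Le], [Bo, Bo, Le]]"

definition "once_paths = [[No, No, No], [No, No, Bo], [No, Bo, No], [No, Bo, Bo],
  [Bo, No, No], [Bo, No, Bo], [Bo, Bo, No], [Bo, Bo, Bo]]"

lemma expect_paths:
  assumes "\<And>A B. f A B = f B A"
  shows "expect (Suc (Suc (Suc n))) k A A f =
    2 * (\<Sum>p\<leftarrow>twice_paths1 @ twice_paths2. path_expect p (Suc (Suc (Suc n))) k A A f / 4 ^ length p) +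
    (\<Sum>p\<leftarrow>once_paths. path_expect p (Suc (Suc (Suc n))) k A A f / 4 ^ length p)"
  by (simp only: expect_symmetric[OF assms])
    (simp add: twice_paths1_def twice_paths2_def once_paths_def addA_def addB_def field_simps)

fun add_sums :: "(real \<times> real \<times> real) list \<Rightarrow> (real \<times> real \<times> real) list \<Rightarrow> (real \<times> real \<times> real) list" where
  "add_sums [] ys = ys"
| "add_sums (x # xs) [] = x # xs"
| "add_sums ((w, m, l) # xs) ((w', m', l') # ys) = (w + w', m + m', l + l') # add_sums xs ys"

fun quarter :: "(real \<times> real \<times> real) list \<Rightarrow> (real \<times> real \<times> real) list" where
  "quarter [] = []" | "quarter ((w, m, l) # xs) = (w / 4, m / 4, l / 4) # quarter xs"

fun row_sums :: "row \<Rightarrow> (real \<times> real \<times> real) list" where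
  "row_sums RE = []" | "row_sums (RC cs r) = (wsum cs, msum cs, lsum cs) # row_sums r"

text \<open>Merging all depths leaves three numbers per gap count, independent of the minorant, so
  one evaluation of the tree serves all bounds.\<close>

fun table_sums :: "table \<Rightarrow> (real \<times> real \<times> real) list" where
  "table_sums TE = []" | "table_sums (TC rw t) = add_sums (row_sums rw) (quarter (table_sums t))"

context minorant
begin

fun sums_value :: "nat \<Rightarrow> (real \<times> real \<times> real) list \<Rightarrow> real" where
  "sums_value c [] = 0"
| "sums_value c ((w, m, l) # xs) = a c * w + b c * m - s c * l + sums_value (Suc c) xs"

lemma sums_value_add: "sums_value c (add_sums xs ys) = sums_value c xs + sums_value c ys"
  by (induction xs ys arbitrary: c rule: add_sums.induct) (simp_all add: algebra_simps)

lemma sums_value_quarter: "sums_value c (quarter xs) = sums_value c xs / 4"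
  by (induction xs arbitrary: c rule: quarter.induct) (simp_all add: field_simps)

lemma sums_value_row: "sums_value c (row_sums rw) = row_value c rw"
  by (induction rw arbitrary: c) simp_all

lemma sums_value_table: "sums_value 0 (table_sums t) = table_value t"
  by (induction t) (simp_all add: sums_value_add sums_value_quarter sums_value_row)

text \<open>\<open>7 + 2 * F\<close> is \<open>k + 2 * (F + 3)\<close> for \<open>k = 1\<close> and
  paths of length 3.\<close>

lemma run_bound:
  assumes "7 + 2 * F \<le> n" "\<And>p. p \<in> set ps \<Longrightarrow> length p \<le> 3"
  shows "table_value (run m F ds ps) \<le> (\<Sum>p\<leftarrow>ps. path_expect p n 1 {0} {0} (target (1 + n)) / 4 ^ length p)"
  using assms(2)
proof (induction ps)
  case (Cons p ps)
  have "unrep {0} {0} 1" by (auto simp: unrep_def)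
  moreover have "\<not> unrep {0} {0} 0" by (auto simp: unrep_def)
  then have "{d. d < 1 \<and> unrep {0} {0} d} = {}" by auto
  ultimately have "state (Opn Bo End) 1 {0} {0} 0"
    by (auto simp: side_of_def gaps_def state_def)
  then have "table_value (descend p m F ds 0 (Opn Bo End)) \<le>
      path_expect p n 1 {0} {0} (target (1 + n)) / 4 ^ length p"
    using assms(1) Cons.prems[of p] by (intro descend_bound) auto
  moreover have "table_value (run m F ds ps) \<le>
      (\<Sum>p\<leftarrow>ps. path_expect p n 1 {0} {0} (target (1 + n)) / 4 ^ length p)"
    by (rule Cons.IH) (use Cons.prems in auto)
  ultimately show ?case by (simp add: table_value_add)
qed simp

lemma paths_bound:
  assumes "7 + 2 * F \<le> n"
  shows "2 * sums_value 0 (table_sums (run m F ds twice_paths1)) +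
      2 * sums_value 0 (table_sums (run m F ds twice_paths2)) +
      sums_value 0 (table_sums (run m F ds once_paths))
    \<le> expect n 1 {0} {0} (target (1 + n))"
proof -
  obtain n' where n: "n = Suc (Suc (Suc n'))"
    using that[of "n - 3"] assms by simp
  have "length p \<le> 3" if "p \<in> set twice_paths1 \<or> p \<in> set twice_paths2 \<or> p \<in> set once_paths" for p
    using that by (auto simp: twice_paths1_def twice_paths2_def once_paths_def)
  then have "table_value (run m F ds ps) \<le> (\<Sum>p\<leftarrow>ps. path_expect p n 1 {0} {0} (target (1 + n)) / 4 ^ length p)"
    if "ps = twice_paths1 \<or> ps = twice_paths2 \<or> ps = once_paths" for ps
    using assms that by (intro run_bound) auto
  from this[of twice_paths1] this[of twice_paths2] this[of once_paths]
  show ?thesis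
    using expect_paths[of "target (1 + n)" n' 1 "{0}"] gaps_commute
    unfolding sums_value_table n[symmetric] target_def by simp
qed

end

section \<open>The limits as smoothed expectations\<close>

text \<open>The coefficient \<open>coef r\<close> is the probability that \<open>min A + min B = r\<close>, so \<open>smooth j m\<close> is the
  probability of \<open>j\<close> gaps, given that there are \<open>m\<close> gaps after \<open>A\<close> and \<open>B\<close> have been shifted to contain 0.\<close>

definition coef :: "nat \<Rightarrow> real" where
  "coef r = real (r + 1) / 2 ^ (r + 2)"

definition smooth :: "nat \<Rightarrow> nat \<Rightarrow> real" where
  "smooth j m = (if m \<le> j then coef (j - m) else 0)"

text \<open>The generating function of \<open>coef\<close> is
  \<open>1 / (4 * (1 - x + x^2 / 4))\<close>, so convolution with \<open>coef\<close> inverts the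
  combination in \<open>cond_ell\<close>.\<close>

lemma coef_rec: "coef (Suc (Suc r)) = coef (Suc r) - coef r / 4"
  by (simp add: coef_def field_simps)

lemma coef_simps: "coef 0 = 1/4" "coef (Suc 0) = 1/4"
  by (simp_all add: coef_def)

definition shifted_ell :: "nat \<Rightarrow> nat \<Rightarrow> real" where
  "shifted_ell k i = (if k \<le> i then ell (2 * (i - k)) else 0)"

text \<open>The limit probability of \<open>i\<close> gaps given that 0 is in both sets:
  \<open>gaps_expect_recursion\<close> solved for its conditional term.\<close>

definition cond_ell :: "nat \<Rightarrow> real" where
  "cond_ell i = 4 * (shifted_ell 0 i - shifted_ell 1 i + shifted_ell 2 i / 4)"

lemma gaps_expect_shifted:
  "(\<lambda>N. gaps_expect N (\<lambda>m. of_bool (m + k = i))) \<longlonglongrightarrow> shifted_ell k i"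
proof (cases "k \<le> i")
  case True
  then have "m + k = i \<longleftrightarrow> m = i - k" for m by auto
  then show ?thesis using True gaps_expect_tendsto[of "i - k"] by (simp add: shifted_ell_def)
next
  case False
  then have "m + k \<noteq> i" for m by auto
  then show ?thesis using False by (simp add: shifted_ell_def gaps_expect_def)
qed

lemma cond_tendsto:
  "(\<lambda>N. expect (Suc N) 1 {0} {0} (\<lambda>A B. of_bool (gaps (Suc (Suc N)) A B = i))) \<longlonglongrightarrow> cond_ell i"
proof -
  have "(\<lambda>N. 4 * (gaps_expect (Suc (Suc N)) (\<lambda>m. of_bool (m + 0 = i)) -
      gaps_expect (Suc N) (\<lambda>m. of_bool (m + 1 = i)) + gaps_expect N (\<lambda>m. of_bool (m + 2 = i)) / 4)) \<longlonglongrightarrow> cond_ell i"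
    unfolding cond_ell_def
    by (intro tendsto_intros gaps_expect_shifted LIMSEQ_Suc[OF gaps_expect_shifted]
        LIMSEQ_Suc[OF LIMSEQ_Suc[OF gaps_expect_shifted]]) simp
  moreover have "expect (Suc N) 1 {0} {0} (\<lambda>A B. of_bool (gaps (Suc (Suc N)) A B = i)) =
      4 * (gaps_expect (Suc (Suc N)) (\<lambda>m. of_bool (m + 0 = i)) -
      gaps_expect (Suc N) (\<lambda>m. of_bool (m + 1 = i)) + gaps_expect N (\<lambda>m. of_bool (m + 2 = i)) / 4)" for N
    using gaps_expect_recursion[of N "\<lambda>m. of_bool (m = i)"] by (simp del: expect.simps)
  ultimately show ?thesis by (simp only:)
qed

lemma coef_convolution: "(\<Sum>c\<le>j. coef (j - c) * cond_ell c) = ell (2 * j)"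
proof (induction j rule: induct_nat_012)
  case 0
  then show ?case by (simp add: coef_simps cond_ell_def shifted_ell_def)
next
  case 1
  then show ?case by (simp add: coef_simps cond_ell_def shifted_ell_def field_simps)
next
  case (ge2 j)
  have "(\<Sum>c\<le>j. coef (Suc (Suc j) - c) * cond_ell c) =
      (\<Sum>c\<le>j. coef (Suc j - c) * cond_ell c - coef (j - c) * cond_ell c / 4)"
    by (intro sum.cong) (auto simp: Suc_diff_le coef_rec algebra_simps)
  also have "\<dots> = (\<Sum>c\<le>j. coef (Suc j - c) * cond_ell c) - ell (2 * j) / 4"
    using ge2(1) by (simp add: sum_subtractf sum_divide_distrib[symmetric])
  also have "(\<Sum>c\<le>j. coef (Suc j - c) * cond_ell c) = ell (2 * Suc j) - coef 0 * cond_ell (Suc j)"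
    using ge2(2) by simp
  finally have "(\<Sum>c\<le>j. coef (Suc (Suc j) - c) * cond_ell c) =
      ell (2 * Suc j) - coef 0 * cond_ell (Suc j) - ell (2 * j) / 4" .
  moreover have "cond_ell (Suc (Suc j)) = 4 * (ell (2 * Suc (Suc j)) - ell (2 * Suc j) + ell (2 * j) / 4)"
    by (simp add: cond_ell_def shifted_ell_def)
  ultimately show ?case by (simp add: coef_simps Suc_diff_le field_simps)
qed

lemma smooth_tendsto:
  "(\<lambda>N. expect (Suc N) 1 {0} {0} (\<lambda>A B. smooth j (gaps (Suc (Suc N)) A B))) \<longlonglongrightarrow> ell (2 * j)"
proof -
  have "smooth j m = (\<Sum>c\<le>j. coef (j - c) * of_bool (m = c))" for m
  proof -
    have "(\<Sum>c\<le>j. coef (j - c) * of_bool (m = c)) = (\<Sum>c\<in>{..j} \<inter> {m}. coef (j - c))"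
      by (rule sum.mono_neutral_cong_right) auto
    then show ?thesis by (simp add: smooth_def)
  qed
  then have "expect (Suc N) 1 {0} {0} (\<lambda>A B. smooth j (gaps (Suc (Suc N)) A B)) =
      (\<Sum>c\<le>j. coef (j - c) * expect (Suc N) 1 {0} {0} (\<lambda>A B. of_bool (gaps (Suc (Suc N)) A B = c)))" for N
    by (simp only: expect_sum expect_scale)
  moreover have "(\<lambda>N. \<Sum>c\<le>j. coef (j - c) * expect (Suc N) 1 {0} {0} (\<lambda>A B. of_bool (gaps (Suc (Suc N)) A B = c)))
      \<longlonglongrightarrow> (\<Sum>c\<le>j. coef (j - c) * cond_ell c)"
    by (intro tendsto_sum tendsto_mult tendsto_const cond_tendsto)
  ultimately show ?thesis by (simp only: coef_convolution)
qed

section \<open>Linear bounds for the smoothed indicator\<close>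

lemma coef_nonneg: "0 \<le> coef r"
  by (simp add: coef_def)

lemma coef_step: "coef m - coef (Suc m) = real m / 2 ^ (m + 3)"
  by (simp add: coef_def field_simps power_add)

lemma coef_antimono: "coef (m + x) \<le> coef m"
proof (induction x)
  case (Suc x)
  have "0 \<le> coef (m + x) - coef (Suc (m + x))" unfolding coef_step by simp
  with Suc show ?case by simp
qed simp

text \<open>A unit step costs \<open>m / 2 ^ (m + 3)\<close>, at most 1/16 as
  \<open>2 * m \<le> 2 ^ m\<close>.\<close>

lemma coef_diff_le: "coef m \<le> coef (m + x) + real x / 16"
proof (induction x)
  case (Suc x)
  have two: "2 * n \<le> 2 ^ n" for n :: nat
  proof (cases n)
    case (Suc m)
    have "Suc m \<le> 2 ^ m" by (rule Suc_leI[OF less_exp])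
    then show ?thesis unfolding Suc power_Suc by (rule mult_le_mono2)
  qed simp
  have "2 * real (m + x) \<le> 2 ^ (m + x)"
    using of_nat_mono[OF two[of "m + x"], where ?'a = real] by simp
  then have "coef (m + x) - coef (Suc (m + x)) \<le> 1 / 16"
    unfolding coef_step by (simp add: field_simps power_add)
  with Suc show ?case by (simp add: field_simps)
qed simp

text \<open>For \<open>x > 0\<close> even \<open>coef m \<le> x / 24\<close>. By monotonicity
  \<open>m = 7 - x\<close> is the worst case for \<open>x < 6\<close>; for \<open>x \<ge> 6\<close>
  the bound \<open>coef 0 = 6/24\<close> fixes the constant.\<close>

lemma coef_diff_le_far:
  assumes "7 \<le> m + x"
  shows "coef m \<le> coef (m + x) + real x / 24"
proof -
  have ub: "coef m \<le> coef i" if "i \<le> m" for i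
    using coef_antimono[of i "m - i"] that by simp
  have vals: "coef 6 = 7/256" "coef 5 = 3/64" "coef 4 = 5/64" "coef 3 = 1/8" "coef 2 = 3/16" "coef 0 = 1/4"
    by (simp_all add: coef_def)
  consider "x = 0" | "x = 1" | "x = 2" | "x = 3" | "x = 4" | "x = 5" | "6 \<le> x" by linarith
  then have "coef m \<le> real x / 24 \<or> x = 0"
  proof cases
    case 2 then show ?thesis using ub[of 6] assms vals by simp
  next
    case 3 then show ?thesis using ub[of 5] assms vals by simp
  next
    case 4 then show ?thesis using ub[of 4] assms vals by simp
  next
    case 5 then show ?thesis using ub[of 3] assms vals by simp
  next
    case 6 then show ?thesis using ub[of 2] assms vals by simp
  next
    case 7 then show ?thesis using ub[of 0] vals by simp
  qed auto
  then show ?thesis using coef_nonneg[of "m + x"] by auto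
qed

text \<open>For \<open>c < j\<close> and \<open>x > 0\<close>, the minorant of \<open>smooth j (c + x)\<close> is the linear function
  \<open>(j - c + 1 - x) / 2 ^ (j - c + 1)\<close>, which is exact at \<open>x = 1\<close> and vanishes at \<open>x = j - c + 1\<close>.\<close>

definition lower_b :: "nat \<Rightarrow> nat \<Rightarrow> real" where
  "lower_b j c = (if c < j then coef (j - c) else 0)"

definition lower_s :: "nat \<Rightarrow> nat \<Rightarrow> real" where
  "lower_s j c = (if c < j then 1 / 2 ^ (j - c + 1) else if c = j then 1/4 else 0)"

text \<open>The minorant of \<open>- smooth j\<close>, for upper bounds, starts at the exact value
  at \<open>c\<close> and falls with slope \<open>upper_s\<close>. Slope 0 suffices for
  \<open>j = c + 1\<close> since \<open>coef 0 = coef 1\<close>; for \<open>c = j\<close> the jump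
  1/4 makes it exact.\<close>

definition upper_a :: "nat \<Rightarrow> nat \<Rightarrow> real" where
  "upper_a j c = - smooth j c"

definition upper_b :: "nat \<Rightarrow> nat \<Rightarrow> real" where
  "upper_b j c = (if c = j then 1/4 else 0)"

definition upper_s :: "nat \<Rightarrow> nat \<Rightarrow> real" where
  "upper_s j c = (if j \<le> c + 1 then 0 else if j \<le> c + 6 then 1/16 else 1/24)"

interpretation lower: minorant "smooth j" "smooth j" "lower_b j" "lower_s j" for j
proof
  fix c x
  show "0 \<le> lower_b j c" "0 \<le> lower_s j c" by (auto simp: lower_b_def lower_s_def coef_nonneg)
  have linear: "smooth j c + lower_b j c * of_bool (0 < x) - lower_s j c * real x =
      (real (j - c + 1) - real x) / 2 ^ (j - c + 1)" if "0 < x" "c < j" for c x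
  proof -
    have "smooth j c = coef (j - c)" "lower_b j c = coef (j - c)" "lower_s j c = 1 / 2 ^ (j - c + 1)"
      using that by (auto simp: smooth_def lower_b_def lower_s_def)
    moreover have "coef (j - c) + coef (j - c) = real (j - c + 1) / 2 ^ (j - c + 1)"
      by (simp add: coef_def)
    ultimately show ?thesis using that by (simp add: diff_divide_distrib)
  qed
  consider "x = 0" | "0 < x" "j < c" | "0 < x" "c = j" | "0 < x" "c < j" "c + x \<le> j" | "0 < x" "c < j" "j < c + x"
    by linarith
  then show "smooth j c + lower_b j c * of_bool (0 < x) - lower_s j c * real x \<le> smooth j (c + x)"
  proof cases
    case 4
    define r where "r = j - c"
    have r: "x \<le> r" "j - (c + x) = r - x" using 4 by (auto simp: r_def)
    have "smooth j c + lower_b j c * of_bool (0 < x) - lower_s j c * real x = (real (r + 1) - real x) / 2 ^ (r + 1)"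
      unfolding r_def by (rule linear[OF 4(1,2)])
    also have "\<dots> = real (r - x + 1) / 2 ^ (r + 1)" using r by simp
    \<comment> \<open>\<open>x > 0\<close> gives \<open>r - x + 2 \<le> r + 1\<close>, so the
      denominator does not grow.\<close>
    also have "\<dots> \<le> real (r - x + 1) / 2 ^ (r - x + 2)"
      using 4(1) r by (intro divide_left_mono power_increasing mult_pos_pos) auto
    also have "\<dots> = smooth j (c + x)" using 4 r by (simp add: smooth_def coef_def)
    finally show ?thesis .
  next
    case 5
    have "smooth j c + lower_b j c * of_bool (0 < x) - lower_s j c * real x \<le> 0"
      unfolding linear[OF 5(1,2)] using 5 by (intro divide_nonpos_pos) auto
    then show ?thesis using 5 by (simp add: smooth_def)
  qed (auto simp: smooth_def lower_b_def lower_s_def coef_simps)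
qed

interpretation upper: minorant "\<lambda>m. - smooth j m" "upper_a j" "upper_b j" "upper_s j" for j
proof
  fix c x
  show "0 \<le> upper_b j c" "0 \<le> upper_s j c" by (auto simp: upper_b_def upper_s_def)
  consider "x = 0" | "0 < x" "j \<le> c" | "c < j" "c + x \<le> j" | "0 < x" "c < j" "j < c + x"
    by linarith
  then show "upper_a j c + upper_b j c * of_bool (0 < x) - upper_s j c * real x \<le> - smooth j (c + x)"
  proof cases
    case 3
    define m where "m = j - (c + x)"
    have m: "j = c + (m + x)" using 3 by (simp add: m_def)
    consider "m + x = 1" | "2 \<le> m + x" "m + x \<le> 6" | "7 \<le> m + x" using 3 m by linarith
    then have "coef m \<le> coef (m + x) + upper_s j c * real x"
    proof cases
      case 1
      then have "m = 1 \<and> x = 0 \<or> m = 0 \<and> x = 1" by linarith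
      then show ?thesis by (auto simp: coef_simps upper_s_def)
    next
      case 2
      then show ?thesis using coef_diff_le[of m x] by (simp add: upper_s_def m)
    next
      case 3
      then show ?thesis using coef_diff_le_far[of m x] by (simp add: upper_s_def m)
    qed
    then show ?thesis using 3 by (simp add: smooth_def upper_a_def upper_b_def m)
  next
    case 4
    have "0 \<le> upper_s j c * real x" by (simp add: upper_s_def)
    then show ?thesis using 4 coef_nonneg[of "j - c"] by (simp add: smooth_def upper_a_def upper_b_def)
  qed (auto simp: smooth_def upper_a_def upper_b_def upper_s_def coef_simps)
qed

text \<open>The finite sum bounds the expectation for all large \<open>N\<close>, whatever
  \<open>m\<close>, \<open>F\<close> and \<open>ds\<close> are, hence also its limit.\<close>

lemma ell_lower_bound:
  "2 * lower.sums_value j 0 (table_sums (run m F ds twice_paths1)) +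
   2 * lower.sums_value j 0 (table_sums (run m F ds twice_paths2)) +
   lower.sums_value j 0 (table_sums (run m F ds once_paths)) \<le> ell (2 * j)"
proof (rule tendsto_lowerbound[OF smooth_tendsto])
  show "\<forall>\<^sub>F N in sequentially.
      2 * lower.sums_value j 0 (table_sums (run m F ds twice_paths1)) +
      2 * lower.sums_value j 0 (table_sums (run m F ds twice_paths2)) +
      lower.sums_value j 0 (table_sums (run m F ds once_paths))
      \<le> expect (Suc N) 1 {0} {0} (\<lambda>A B. smooth j (gaps (Suc (Suc N)) A B))"
    using eventually_ge_at_top[of "7 + 2 * F"]
  proof eventually_elim
    case (elim N)
    then show ?case
      using lower.paths_bound[of F "Suc N" j m ds] by (simp add: lower.target_def[abs_def])
  qed
qed simp

lemma ell_upper_bound: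
  "ell (2 * j) \<le> - (2 * upper.sums_value j 0 (table_sums (run m F ds twice_paths1)) +
   2 * upper.sums_value j 0 (table_sums (run m F ds twice_paths2)) +
   upper.sums_value j 0 (table_sums (run m F ds once_paths)))"
proof (rule tendsto_upperbound[OF smooth_tendsto])
  have neg: "expect n (Suc 0) {0} {0} (\<lambda>A B. - f A B) = - expect n (Suc 0) {0} {0} f" for n f
    using expect_scale[of n "Suc 0" "{0}" "{0}" "-1" f] by simp
  show "\<forall>\<^sub>F N in sequentially. expect (Suc N) 1 {0} {0} (\<lambda>A B. smooth j (gaps (Suc (Suc N)) A B)) \<le>
      - (2 * upper.sums_value j 0 (table_sums (run m F ds twice_paths1)) +
      2 * upper.sums_value j 0 (table_sums (run m F ds twice_paths2)) +
      upper.sums_value j 0 (table_sums (run m F ds once_paths)))"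
    using eventually_ge_at_top[of "7 + 2 * F"]
  proof eventually_elim
    case (elim N)
    then show ?case
      using upper.paths_bound[of F "Suc N" j m ds] by (simp add: upper.target_def[abs_def] neg del: expect.simps)
  qed
qed simp

section \<open>Evaluation of the case tree\<close>

lemmas machine_simps = node.simps branch.simps(1,2) branch_False next_fuel.simps drop_fuel.simps list.sel(3)
  ext.simps dec1.simps dec2.simps add_leaf.simps leaf1.simps leaf2.simps inc.simps
  run.simps descend.simps side.distinct if_True if_False simp_thms(6) tree.simps expand.simps(1,2) expand_False
  add_bin.simps add_cells.simps add_row.simps add_table.simps

text \<open>The fuel and its costs are chosen such that the case tree is barely fine enough for the bounds
  of the theorem. Entry \<open>c\<close> of a list contains the total weight of the leaves with \<open>c\<close> gaps, and the
  weighted sums of their \<open>mu\<close> and \<open>lam\<close>.\<close>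

lemma table_sums_twice_paths1:
  "table_sums (run 5 25 [0, 0, 0, 1, 1, 1, 7] twice_paths1) =
   [(2395893/16777216, 909312133/549755813888, 328301605/137438953472),
    (529533/8388608, 115202179/68719476736, 330328655/137438953472),
    (451931/16777216, 351456055/274877906944, 131074601/68719476736),
    (90843/8388608, 235956607/274877906944, 93063369/68719476736),
    (18053/4194304, 18825353/34359738368, 18602057/17179869184),
    (3005/2097152, 240351/1073741824, 610957/1073741824),
    (2013/4194304, 3227/33554432, 1493719/4294967296),
    (89/1048576, 177/8388608, 3493/33554432)]"
  \<comment> \<open>Numerals become \<open>Suc\<close> terms for pattern matching. The first
    rewriting yields a table of binary counters, the second its rational sums.\<close>
  unfolding twice_paths1_def eval_nat_numeral BitM.simps One_nat_def
  by (simp only: machine_simps) simp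

lemma table_sums_twice_paths2:
  "table_sums (run 5 25 [0, 0, 0, 1, 1, 1, 7] twice_paths2) =
   [(86853/1048576, 97587407/137438953472, 18499913/17179869184),
    (842385/16777216, 291668073/274877906944, 52229357/34359738368),
    (238337/8388608, 158309049/137438953472, 111282939/68719476736),
    (31809/2097152, 154775261/137438953472, 108305265/68719476736),
    (57773/8388608, 31243135/34359738368, 12039811/8589934592),
    (46523/16777216, 17535363/34359738368, 35496779/34359738368),
    (2011/2097152, 3745/16777216, 5224317/8589934592),
    (549/2097152, 547/8388608, 21589/67108864)]"
  unfolding twice_paths2_def eval_nat_numeral BitM.simps One_nat_def
  by (simp only: machine_simps) simp

lemma table_sums_once_paths:
  "table_sums (run 5 25 [0, 0, 0, 1, 1, 1, 7] once_paths) =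
   [(183709/4194304, 2395255/8589934592, 3742153/8589934592),
    (57141/2097152, 8126467/17179869184, 5913315/8589934592),
    (98779/4194304, 12209243/17179869184, 17662035/17179869184),
    (229555/16777216, 3040265/4294967296, 35725977/34359738368),
    (146267/16777216, 4280461/4294967296, 11801085/8589934592),
    (39501/8388608, 4043433/4294967296, 54140509/34359738368),
    (2215/1048576, 2137/4194304, 4937007/4294967296),
    (619/524288, 619/2097152, 6744137/4294967296)]"
  unfolding once_paths_def eval_nat_numeral BitM.simps One_nat_def
  by (simp only: machine_simps) simp

lemmas table_sums_values = table_sums_twice_paths1 table_sums_twice_paths2 table_sums_once_paths

lemmas ell_lower_value =
  ell_lower_bound[where m = 5 and F = 25 and ds = "[0, 0, 0, 1, 1, 1, 7]", unfolded table_sums_values]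

lemmas ell_upper_value =
  ell_upper_bound[where m = 5 and F = 25 and ds = "[0, 0, 0, 1, 1, 1, 7]", unfolded table_sums_values]

lemmas value_simps = smooth_def coef_def lower_b_def lower_s_def upper_a_def upper_b_def upper_s_def

lemma ell_0_bounds: "0.12165 < ell 0" "ell 0 < 0.12255"
  using ell_lower_value[of 0] ell_upper_value[of 0] by (simp_all add: value_simps)

lemma ell_2_bounds: "0.18434 < ell 2" "ell 2 < 0.18614"
  using ell_lower_value[of 1] ell_upper_value[of 1] by (simp_all add: value_simps)

lemma ell_4_bounds: "0.18713 < ell 4" "ell 4 < 0.18959"
  using ell_lower_value[of 2] ell_upper_value[of 2] by (simp_all add: value_simps)

lemma ell_6_bounds: "0.15728 < ell 6" "ell 6 < 0.16019"
  using ell_lower_value[of 3] ell_upper_value[of 3] by (simp_all add: value_simps)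

lemma ell_8_bounds: "0.11801 < ell 8" "ell 8 < 0.12119"
  using ell_lower_value[of 4] ell_upper_value[of 4] by (simp_all add: value_simps)

lemma ell_10_bounds: "0.08188 < ell 10" "ell 10 < 0.08523"
  using ell_lower_value[of 5] ell_upper_value[of 5] by (simp_all add: value_simps)

lemma ell_12_bounds: "0.05355 < ell 12" "ell 12 < 0.05700"
  using ell_lower_value[of 6] ell_upper_value[of 6] by (simp_all add: value_simps)

lemma ell_14_bounds: "0.03334 < ell 14" "ell 14 < 0.03685"
  using ell_lower_value[of 7] ell_upper_value[of 7] by (simp_all add: value_simps)

lemma ell_16_bounds: "0.01981 < ell 16" "ell 16 < 0.02335"
  using ell_lower_value[of 8] ell_upper_value[of 8] by (simp_all add: value_simps)

lemma ell_18_bounds: "0.01115 < ell 18" "ell 18 < 0.01471"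
  using ell_lower_value[of 9] ell_upper_value[of 9] by (simp_all add: value_simps)

lemma ell_20_bounds: "0.00580 < ell 20" "ell 20 < 0.00937"
  using ell_lower_value[of 10] ell_upper_value[of 10] by (simp_all add: value_simps)

theorem theorem3p20:
  shows "(\<forall>k. convergent (\<lambda>n. missing_prob n k)) \<and>
    0.12165 < ell 0 \<and> ell 0 < 0.12255 \<and>
    0.18434 < ell 2 \<and> ell 2 < 0.18614 \<and>
    0.18713 < ell 4 \<and> ell 4 < 0.18959 \<and>
    0.15728 < ell 6 \<and> ell 6 < 0.16019 \<and>
    0.11801 < ell 8 \<and> ell 8 < 0.12119 \<and>
    0.08188 < ell 10 \<and> ell 10 < 0.08523 \<and>
    0.05355 < ell 12 \<and> ell 12 < 0.05700 \<and>
    0.03334 < ell 14 \<and> ell 14 < 0.03685 \<and>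
    0.01981 < ell 16 \<and> ell 16 < 0.02335 \<and>
    0.01115 < ell 18 \<and> ell 18 < 0.01471 \<and>
    0.00580 < ell 20 \<and> ell 20 < 0.00937"
  using missing_prob_convergent_all ell_0_bounds ell_2_bounds ell_4_bounds ell_6_bounds ell_8_bounds
    ell_10_bounds ell_12_bounds ell_14_bounds ell_16_bounds ell_18_bounds ell_20_bounds
  by blast

end
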